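(* Let $P(X) = a_n X^{n}+ \sum_{i=0}^m a_{i} X^{i}$, where $0 \le m < n$, all $a_i \in \mathbf{C}$, and $a_n, a_m \ne 0$, be a polynomial of degree $n$. Let $I = \{i \mid a_i \ne 0\}$ (the set of exponents occurring in $P$ with nonzero coefficient), $l = \min \{i \mid i \in I\}$ and $J =\{i-l \mid i\in I\}$. Then the following statements hold. (i) If $n - m \ge 3$, then $P$ is a strong uniqueness polynomial for rational functions if and only if the greatest common divisor of the indices in $I$ is $1$ and the greatest common divisor of the indices in $J$ is also $1$. (ii) If $n - m \ge 4$, then $P$ is a strong uniqueness polynomial for meromorphic functions if and only if the greatest common divisor of the indices in $I$ is $1$ and the greatest common divisor of the indices in $J$ is also $1$.
   Context: Meromorphic functions are meromorphic functions on $\mathbf{C}$; rational functions are rational functions over $\mathbf{C}$ in one variable. A polynomial $P$ over $\mathbf{C}$ is a strong uniqueness polynomial for meromorphic (respectively, rational) functions if, whenever $f,g$ are non-constant meromorphic (respectively, rational) functions and $c$ is a non-zero complex constant with $P(f)=cP(g)$, one has $c=1$ and $f\equiv g$. Convention: $0$ is divisible by all integers (so an index $0$ in $I$ or $J$ does not affect the greatest common divisor). *)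

theory Defs
  imports "HOL-Complex_Analysis.Complex_Analysis"
    "HOL-Computational_Algebra.Computational_Algebra"
begin

text \<open>
  A function that is \<open>meromorphic_on UNIV\<close> may take arbitrary values on a sparse set
  (in particular at its poles). Identities between meromorphic functions, and being constant,
  are therefore always understood outside a sparse set, i.e. with \<open>\<forall>\<^sub>\<approx>z\<close>.
\<close>

definition nonconst_meromorphic :: "(complex \<Rightarrow> complex) \<Rightarrow> bool" where
  "nonconst_meromorphic f \<longleftrightarrow>
     f meromorphic_on UNIV \<and> \<not> (\<exists>k. \<forall>\<^sub>\<approx>z. f z = k)"

definition strong_uniqueness_poly_meromorphic :: "complex poly \<Rightarrow> bool" where
  "strong_uniqueness_poly_meromorphic P \<longleftrightarrow>
     (\<forall>f g. \<forall>c::complex.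
        nonconst_meromorphic f \<longrightarrow> nonconst_meromorphic g \<longrightarrow> c \<noteq> 0 \<longrightarrow>
        (\<forall>\<^sub>\<approx>z. poly P (f z) = c * poly P (g z)) \<longrightarrow>
        c = 1 \<and> (\<forall>\<^sub>\<approx>z. f z = g z))"

text \<open>Rational functions in one variable are the elements of the fraction field
  of \<open>complex poly\<close>; the constant ones are those in the range of \<open>rat_const\<close>.\<close>

definition rat_const :: "complex \<Rightarrow> complex poly fract" where
  "rat_const k = to_fract [:k:]"

definition strong_uniqueness_poly_rational :: "complex poly \<Rightarrow> bool" where
  "strong_uniqueness_poly_rational P \<longleftrightarrow>
     (\<forall>f g. \<forall>c::complex.
        f \<notin> range rat_const \<longrightarrow> g \<notin> range rat_const \<longrightarrow> c \<noteq> 0 \<longrightarrow>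
        poly (map_poly rat_const P) f = rat_const c * poly (map_poly rat_const P) g \<longrightarrow>
        c = 1 \<and> f = g)"

end

theory Submission
  imports Defs "HOL-Computational_Algebra.Field_as_Ring"
begin

text \<open>
  Suppose \<open>P(f) = c P(g)\<close> and let \<open>w = f g' - f' g\<close>. The point is to show \<open>w = 0\<close>: then \<open>f = d g\<close> for a
  constant \<open>d\<close>, comparing coefficients gives \<open>d\<^sup>i = c\<close> for all \<open>i \<in> I\<close>, hence \<open>d\<^sup>j = 1\<close> for all
  \<open>j \<in> J\<close>, and \<open>d = c = 1\<close> if \<open>Gcd J = 1\<close>. Conversely, a root of unity \<open>d\<close> of order \<open>Gcd J\<close> gives
  \<open>P(d z) = d\<^sup>l P(z)\<close>. As \<open>Gcd I\<close> divides \<open>Gcd J\<close>, the condition on \<open>I\<close> follows from that on \<open>J\<close>.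

  For rational functions with common denominator \<open>q\<close>, the gap in \<open>P\<close> makes \<open>q\<^sup>2 w\<close> a polynomial divisible
  by \<open>q\<^sup>2\<close>, and a degree count shows that it vanishes; so \<open>w dz\<close> is a regular \<open>1\<close>-form on the sphere.

  For meromorphic functions and \<open>n - m \<ge> 4\<close>, the functions \<open>w\<close>, \<open>w f\<close>, \<open>w g\<close> are all entire, and the sum
  \<open>S\<close> of the squares of their absolute values satisfies \<open>\<Delta> log S \<ge> k S\<close> with \<open>k > 0\<close>. By
  Ahlfors' lemma the plane carries no such metric, so \<open>S = 0\<close>. This replaces Nevanlinna theory.
\<close>

subsection \<open>Negatively curved metrics on the plane\<close>

text \<open>If \<open>u > 0\<close>, then \<open>U'\<close> is positive just to the right of 0 and
  the mean value theorem produces a larger value of \<open>U\<close>. A test in one real variable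
  suffices because the maximum principle is applied along lines through the maximum point.\<close>

lemma second_derivative_nonpos_at_max:
  fixes U U' :: "real \<Rightarrow> real"
  assumes d: "d > 0" and max: "\<And>t. \<bar>t\<bar> < d \<Longrightarrow> U t \<le> U 0"
    and U: "\<And>t. (U has_real_derivative U' t) (at t)"
    and U': "(U' has_real_derivative u) (at 0)"
  shows "U' 0 = 0" "u \<le> 0"
proof -
  show 0: "U' 0 = 0"
    using DERIV_local_max[OF U[of 0] d] max by simp
  show "u \<le> 0"
  proof (rule ccontr)
    assume "\<not> u \<le> 0"
    then obtain e where e: "e > 0" "\<And>h. h > 0 \<Longrightarrow> h < e \<Longrightarrow> U' 0 < U' (0 + h)"
      using DERIV_pos_inc_right[OF U'] by (metis not_le)
    define h where "h = min d e / 2"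
    have h: "h > 0" "h < d" "h < e" using d e(1) by (auto simp: h_def)
    obtain z where z: "0 < z" "z < h" "U h - U 0 = (h - 0) * U' z"
      using MVT2[OF h(1), of U U'] U by blast
    have "U' z > 0" using e(2)[of z] z h 0 by simp
    hence "U h > U 0" using z h by (smt (verit) mult_pos_pos)
    thus False using max[of h] h by simp
  qed
qed

text \<open>Derivatives along the line through \<open>z\<close> with direction \<open>e\<close>
  stand in for partial derivatives; \<open>e = 1\<close> and \<open>e = \<i>\<close> give those in x
  and y.\<close>

lemma norm_square_line_deriv:
  fixes F F' :: "complex \<Rightarrow> complex" and z e :: complex
  assumes F: "\<And>z. (F has_field_derivative F' z) (at z)"
  shows "((\<lambda>t. (norm (F (z + of_real t * e)))\<^sup>2) has_real_derivative
           2 * Re (cnj (F (z + of_real t * e)) * (F' (z + of_real t * e) * e))) (at t)"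
proof -
  have 1: "((\<lambda>t. F (z + of_real t * e)) has_vector_derivative F' (z + of_real t * e) * e) (at t)"
    by (rule field_vector_diff_chain_at[OF _ F, unfolded o_def, THEN has_vector_derivative_eq_rhs])
       (auto intro!: derivative_eq_intros)
  have re: "((\<lambda>t. Re (F (z + of_real t * e))) has_real_derivative Re (F' (z + of_real t * e) * e)) (at t)"
    using bounded_linear.has_vector_derivative[OF bounded_linear_Re 1]
    by (simp add: has_real_derivative_iff_has_vector_derivative)
  have im: "((\<lambda>t. Im (F (z + of_real t * e))) has_real_derivative Im (F' (z + of_real t * e) * e)) (at t)"
    using bounded_linear.has_vector_derivative[OF bounded_linear_Im 1]
    by (simp add: has_real_derivative_iff_has_vector_derivative)
  show ?thesis
    unfolding cmod_power2
    by (rule derivative_eq_intros re im refl | simp)+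
qed

text \<open>The direction enters the \<open>F''\<close> term only through the square of
  \<open>e\<close>. Hence this term cancels when the directions 1 and i are added, and the Laplacian
  of |F|^2 is 4 |F'|^2.\<close>

lemma Re_cnj_line_deriv:
  fixes F F' F'' :: "complex \<Rightarrow> complex" and z e :: complex
  assumes F: "\<And>z. (F has_field_derivative F' z) (at z)"
    and F': "\<And>z. (F' has_field_derivative F'' z) (at z)"
  shows "((\<lambda>t. 2 * Re (cnj (F (z + of_real t * e)) * (F' (z + of_real t * e) * e))) has_real_derivative
           2 * (norm (F' (z + of_real t * e) * e))\<^sup>2 + 2 * Re (cnj (F (z + of_real t * e)) * (F'' (z + of_real t * e) * e\<^sup>2))) (at t)"
proof -
  have 1: "((\<lambda>t. F (z + of_real t * e)) has_vector_derivative F' (z + of_real t * e) * e) (at t)"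
    by (rule field_vector_diff_chain_at[OF _ F, unfolded o_def, THEN has_vector_derivative_eq_rhs])
       (auto intro!: derivative_eq_intros)
  have 2: "((\<lambda>t. F' (z + of_real t * e)) has_vector_derivative F'' (z + of_real t * e) * e) (at t)"
    by (rule field_vector_diff_chain_at[OF _ F', unfolded o_def, THEN has_vector_derivative_eq_rhs])
       (auto intro!: derivative_eq_intros)
  have 3: "((\<lambda>t. cnj (F (z + of_real t * e)) * (F' (z + of_real t * e) * e)) has_vector_derivative
     (cnj (F (z + of_real t * e)) * (F'' (z + of_real t * e) * e * e) + cnj (F' (z + of_real t * e) * e) * (F' (z + of_real t * e) * e))) (at t)"
    by (intro has_vector_derivative_mult has_vector_derivative_cnj 1 has_vector_derivative_mult_left 2)
  have "((\<lambda>t. 2 * Re (cnj (F (z + of_real t * e)) * (F' (z + of_real t * e) * e))) has_real_derivative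
     2 * Re (cnj (F (z + of_real t * e)) * (F'' (z + of_real t * e) * e * e) + cnj (F' (z + of_real t * e) * e) * (F' (z + of_real t * e) * e))) (at t)"
    using bounded_linear.has_vector_derivative[OF bounded_linear_Re 3]
    by (intro DERIV_cmult) (simp add: has_real_derivative_iff_has_vector_derivative)
  moreover have "Re (cnj (F' (z + of_real t * e) * e) * (F' (z + of_real t * e) * e)) = (norm (F' (z + of_real t * e) * e))\<^sup>2"
    by (metis Re_complex_of_real complex_norm_square mult.commute)
  ultimately show ?thesis
    by (simp add: power2_eq_square algebra_simps del: times_complex.simps)
qed

text \<open>\<open>sx, sy, sxx, syy\<close> stand for the partial derivatives of \<open>S\<close> at a point where \<open>S q\<^sup>2\<close> is maximal.\<close>

lemma laplacian_le_at_max: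
  fixes S q x y sx sy sxx syy R :: real
  assumes "S > 0" "q > 0" "q = R\<^sup>2 - (x\<^sup>2 + y\<^sup>2)"
    and "sx * q\<^sup>2 + S * (2 * q * (- 2 * x)) = 0"
    and "sy * q\<^sup>2 + S * (2 * q * (- 2 * y)) = 0"
    and "sxx * q\<^sup>2 + 2 * sx * (2 * q * (-2 * x)) + S * (8 * x\<^sup>2 - 4 * q) \<le> 0"
    and "syy * q\<^sup>2 + 2 * sy * (2 * q * (-2 * y)) + S * (8 * y\<^sup>2 - 4 * q) \<le> 0"
  shows "(S * (sxx + syy) - (sx\<^sup>2 + sy\<^sup>2)) * q\<^sup>2 \<le> 8 * R\<^sup>2 * S\<^sup>2"
proof -
  have R2: "R\<^sup>2 = q + (x\<^sup>2 + y\<^sup>2)" using assms(3) by simp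
  have "q * (sx * q - 4 * S * x) = 0" "q * (sy * q - 4 * S * y) = 0"
    using assms(4,5) by (simp_all add: power2_eq_square algebra_simps)
  \<comment> \<open>The critical point equations say that the gradient of log S is 4 (x, y) /
    q.\<close>
  hence sx: "sx * q = 4 * S * x" and sy: "sy * q = 4 * S * y" using assms(2) by auto
  have x2: "2 * sx * (2 * q * (-2 * x)) = - (32 * S * x\<^sup>2)"
    using arg_cong[OF sx, of "\<lambda>t. -8 * x * t"] by (simp add: power2_eq_square algebra_simps)
  have y2: "2 * sy * (2 * q * (-2 * y)) = - (32 * S * y\<^sup>2)"
    using arg_cong[OF sy, of "\<lambda>t. -8 * y * t"] by (simp add: power2_eq_square algebra_simps)
  have "(sxx + syy) * q\<^sup>2 \<le> S * (24 * (x\<^sup>2 + y\<^sup>2) + 8 * q)"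
    using assms(6,7) x2 y2 by (simp add: algebra_simps)
  hence "S * ((sxx + syy) * q\<^sup>2) \<le> S * (S * (24 * (x\<^sup>2 + y\<^sup>2) + 8 * q))"
    using assms(1) by (simp add: mult_left_mono)
  moreover have "(sx\<^sup>2 + sy\<^sup>2) * q\<^sup>2 = 16 * S\<^sup>2 * (x\<^sup>2 + y\<^sup>2)"
    using arg_cong[OF sx, of "\<lambda>t. t\<^sup>2"] arg_cong[OF sy, of "\<lambda>t. t\<^sup>2"]
    by (simp add: power_mult_distrib algebra_simps)
  \<comment> \<open>The quadratic terms leave 24 - 16 = 8, and x^2 + y^2 + q = R^2.\<close>
  moreover have "S * (S * (24 * (x\<^sup>2 + y\<^sup>2) + 8 * q)) - 16 * S\<^sup>2 * (x\<^sup>2 + y\<^sup>2) = 8 * R\<^sup>2 * S\<^sup>2"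
    unfolding R2 by (simp add: power2_eq_square algebra_simps)
  ultimately show ?thesis by (simp add: algebra_simps)
qed

text \<open>For a holomorphic triple and its derivative, four times the left-hand side is S^2 times
  the Laplacian of log S. So the curvature of the metric is read off from the 2 x 2 minors of the
  triple and its derivative.\<close>

lemma lagrange_identity_3:
  fixes a b c a' b' c' :: complex
  shows "((norm a)\<^sup>2 + (norm b)\<^sup>2 + (norm c)\<^sup>2) * ((norm a')\<^sup>2 + (norm b')\<^sup>2 + (norm c')\<^sup>2)
     - (norm (cnj a * a' + cnj b * b' + cnj c * c'))\<^sup>2
    = (norm (a * b' - a' * b))\<^sup>2 + (norm (a * c' - a' * c))\<^sup>2 + (norm (b * c' - b' * c))\<^sup>2"
proof -
  \<comment> \<open>Over the complex numbers each |z|^2 becomes z times \<open>cnj z\<close>, and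
    the claim turns into a polynomial identity.\<close>
  have "complex_of_real (((norm a)\<^sup>2 + (norm b)\<^sup>2 + (norm c)\<^sup>2) * ((norm a')\<^sup>2 + (norm b')\<^sup>2 + (norm c')\<^sup>2)
     - (norm (cnj a * a' + cnj b * b' + cnj c * c'))\<^sup>2)
    = complex_of_real ((norm (a * b' - a' * b))\<^sup>2 + (norm (a * c' - a' * c))\<^sup>2 + (norm (b * c' - b' * c))\<^sup>2)"
    by (simp only: of_real_add of_real_diff of_real_mult complex_norm_square
        complex_cnj_add complex_cnj_diff complex_cnj_mult complex_cnj_cnj) algebra
  thus ?thesis by (simp only: of_real_eq_iff)
qed

text \<open>The hypothesis says that \<open>S = \<bar>A\<bar>\<^sup>2 + \<bar>B\<bar>\<^sup>2 + \<bar>C\<bar>\<^sup>2\<close> is the density of a metric whose curvature is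
  bounded above by a negative constant. Comparing it on the disc of radius \<open>R\<close> with the
  hyperbolic metric, at the point where the ratio is largest, gives \<open>S = O(1 / R\<^sup>2)\<close> at the centre.\<close>

lemma negatively_curved_entire_triple_eq_0:
  fixes A B C :: "complex \<Rightarrow> complex"
  assumes hol: "A holomorphic_on UNIV" "B holomorphic_on UNIV" "C holomorphic_on UNIV"
    and k: "k > 0"
    and curv: "\<And>z. k * ((norm (A z))\<^sup>2 + (norm (B z))\<^sup>2 + (norm (C z))\<^sup>2) ^ 3 \<le>
      (norm (A z * deriv B z - deriv A z * B z))\<^sup>2 + (norm (A z * deriv C z - deriv A z * C z))\<^sup>2
      + (norm (B z * deriv C z - deriv B z * C z))\<^sup>2"
  shows "A w = 0" "B w = 0" "C w = 0"
proof -
  define S where "S = (\<lambda>z. (norm (A z))\<^sup>2 + (norm (B z))\<^sup>2 + (norm (C z))\<^sup>2)"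
  have D1: "(F has_field_derivative deriv F z) (at z)" if "F holomorphic_on UNIV" for F :: "complex \<Rightarrow> complex" and z
    using that by (simp add: holomorphic_derivI)
  have D2: "(deriv F has_field_derivative deriv (deriv F) z) (at z)" if "F holomorphic_on UNIV" for F :: "complex \<Rightarrow> complex" and z
    using that by (intro D1 holomorphic_deriv) auto
  have contS: "continuous_on X S" for X
    unfolding S_def using hol
    by (intro continuous_intros holomorphic_on_imp_continuous_on) (auto intro: holomorphic_on_subset)
  have bound: "k * S w * R\<^sup>2 \<le> 2" if R: "R > 0" for R :: real
  proof (cases "S w > 0")
    case False
    hence "k * S w * R\<^sup>2 \<le> 0" using k by (simp add: S_def mult_nonneg_nonpos mult_nonpos_nonneg not_less)
    thus ?thesis by simp
  next
    case True
    \<comment> \<open>Up to a constant factor, 1 / q^2 is the density of the hyperbolic metric on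
      the disc of radius \<open>R\<close> about \<open>w\<close>, so S q^2 is the ratio of the two
      metrics. It vanishes on the boundary circle, which forces its maximum into the
      interior.\<close>
    define q where "q = (\<lambda>z. R\<^sup>2 - (norm (z - w))\<^sup>2)"
    have "\<exists>z0\<in>cball w R. \<forall>z\<in>cball w R. S z * (q z)\<^sup>2 \<le> S z0 * (q z0)\<^sup>2"
      using R unfolding q_def by (intro continuous_attains_sup) (auto intro!: continuous_intros contS)
    then obtain z0 where z0: "z0 \<in> cball w R" "\<And>z. z \<in> cball w R \<Longrightarrow> S z * (q z)\<^sup>2 \<le> S z0 * (q z0)\<^sup>2"
      by blast
    have U0: "S w * R ^ 4 \<le> S z0 * (q z0)\<^sup>2"
      using z0(2)[of w] R by (simp add: q_def power_mult[symmetric])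
    have Upos: "S z0 * (q z0)\<^sup>2 > 0"
      using U0 True R by (smt (verit) zero_less_mult_iff zero_less_power)
    have Spos: "S z0 > 0"
      using Upos by (simp add: zero_less_mult_iff S_def)
    have "q z0 \<ge> 0" using z0(1) by (simp add: q_def dist_norm norm_minus_commute power_mono)
    with Upos have qpos: "q z0 > 0" by (cases "q z0 = 0") auto
    hence "norm (z0 - w) < R" using R by (simp add: q_def power2_less_imp_less)
    define d where "d = R - norm (z0 - w)"
    have d: "d > 0" using \<open>norm (z0 - w) < R\<close> by (simp add: d_def)
    have in_ball: "z0 + of_real t * e \<in> cball w R" if "norm e = 1" "\<bar>t\<bar> < d" for t e
    proof -
      have "norm (z0 + of_real t * e - w) \<le> norm (z0 - w) + norm (of_real t * e)"
        by (metis add_diff_eq add.commute diff_add_eq norm_triangle_ineq)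
      thus ?thesis using that by (simp add: d_def dist_norm norm_minus_commute norm_mult)
    qed
    \<comment> \<open>\<open>S1 e\<close> and \<open>S2 e\<close> are the first and second
      derivatives of \<open>S\<close> in direction \<open>e\<close>, and \<open>q1 e\<close> is the
      first derivative of \<open>q\<close>. Along a unit vector \<open>q\<close> has second
      derivative -2, so that of q^2 is 2 (q1)^2 - 4 q.\<close>
    define S1 where "S1 = (\<lambda>e z. 2 * Re (cnj (A z) * (deriv A z * e)) + 2 * Re (cnj (B z) * (deriv B z * e))
       + 2 * Re (cnj (C z) * (deriv C z * e)))"
    define S2 where "S2 = (\<lambda>e z. (2 * (norm (deriv A z * e))\<^sup>2 + 2 * Re (cnj (A z) * (deriv (deriv A) z * e\<^sup>2)))
       + (2 * (norm (deriv B z * e))\<^sup>2 + 2 * Re (cnj (B z) * (deriv (deriv B) z * e\<^sup>2)))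
       + (2 * (norm (deriv C z * e))\<^sup>2 + 2 * Re (cnj (C z) * (deriv (deriv C) z * e\<^sup>2))))"
    define q1 where "q1 = (\<lambda>e z. - (2 * Re (cnj (z - w) * (1 * e))))"
    have dir: "S1 e z0 * (q z0)\<^sup>2 + S z0 * (2 * q z0 * q1 e z0) = 0"
      "S2 e z0 * (q z0)\<^sup>2 + 2 * S1 e z0 * (2 * q z0 * q1 e z0) + S z0 * (2 * (q1 e z0)\<^sup>2 - 4 * q z0) \<le> 0"
      if e: "norm e = 1" for e
    proof -
      let ?l = "\<lambda>t. z0 + of_real t * e"
      have dS: "((\<lambda>t. S (?l t)) has_real_derivative S1 e (?l t)) (at t)" for t
        unfolding S_def S1_def by (intro DERIV_add norm_square_line_deriv D1 hol)
      have dS1: "((\<lambda>t. S1 e (?l t)) has_real_derivative S2 e (?l t)) (at t)" for t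
        unfolding S1_def S2_def by (intro DERIV_add Re_cnj_line_deriv D1 D2 hol)
      have id1: "((\<lambda>z. z - w) has_field_derivative 1) (at z)" for z
        by (auto intro!: derivative_eq_intros)
      have id2: "((\<lambda>z. 1::complex) has_field_derivative 0) (at z)" for z :: complex
        by simp
      have dq: "((\<lambda>t. q (?l t)) has_real_derivative q1 e (?l t)) (at t)" for t
        using DERIV_diff[OF DERIV_const norm_square_line_deriv[OF id1]] unfolding q_def q1_def by simp
      have dq1: "((\<lambda>t. q1 e (?l t)) has_real_derivative -2) (at t)" for t
        using DERIV_minus[OF Re_cnj_line_deriv[OF id1 id2, of z0 e]] e unfolding q1_def by simp
      let ?U1 = "\<lambda>t. S1 e (?l t) * (q (?l t))\<^sup>2 + S (?l t) * (2 * q (?l t) * q1 e (?l t))"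
      have U: "((\<lambda>t. S (?l t) * (q (?l t))\<^sup>2) has_real_derivative ?U1 t) (at t)" for t
        by (rule derivative_eq_intros dS dq refl)+ (simp add: algebra_simps)
      have U1: "(?U1 has_real_derivative (S2 e (?l t) * (q (?l t))\<^sup>2 + 2 * S1 e (?l t) * (2 * q (?l t) * q1 e (?l t))
          + S (?l t) * (2 * (q1 e (?l t))\<^sup>2 - 4 * q (?l t)))) (at t)" for t
        by (rule derivative_eq_intros dS dS1 dq dq1 refl)+ (simp add: algebra_simps power2_eq_square)
      have max: "S (?l t) * (q (?l t))\<^sup>2 \<le> S (?l 0) * (q (?l 0))\<^sup>2" if "\<bar>t\<bar> < d" for t
        using z0(2)[OF in_ball[OF e that]] by simp
      note * = second_derivative_nonpos_at_max[OF d max U U1[of 0]]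
      show "S1 e z0 * (q z0)\<^sup>2 + S z0 * (2 * q z0 * q1 e z0) = 0" using *(1) by simp
      show "S2 e z0 * (q z0)\<^sup>2 + 2 * S1 e z0 * (2 * q z0 * q1 e z0) + S z0 * (2 * (q1 e z0)\<^sup>2 - 4 * q z0) \<le> 0"
        using *(2) by simp
    qed
    define x where "x = Re (z0 - w)"
    define y where "y = Im (z0 - w)"
    have q0: "q z0 = R\<^sup>2 - (x\<^sup>2 + y\<^sup>2)" by (simp add: q_def x_def y_def cmod_power2)
    have q1x: "q1 1 z0 = - 2 * x" and q1y: "q1 \<i> z0 = - 2 * y"
      by (simp_all add: q1_def x_def y_def)
    have "(S z0 * (S2 1 z0 + S2 \<i> z0) - ((S1 1 z0)\<^sup>2 + (S1 \<i> z0)\<^sup>2)) * (q z0)\<^sup>2 \<le> 8 * R\<^sup>2 * (S z0)\<^sup>2"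
      using dir[of 1] dir[of \<i>] by (intro laplacian_le_at_max[OF Spos qpos q0]) (simp_all add: q1x q1y power_mult_distrib)
    \<comment> \<open>The terms with second derivatives of \<open>A\<close>, \<open>B\<close>,
      \<open>C\<close> cancel because 1 + i^2 = 0.\<close>
    moreover have "S2 1 z0 + S2 \<i> z0 = 4 * ((norm (deriv A z0))\<^sup>2 + (norm (deriv B z0))\<^sup>2 + (norm (deriv C z0))\<^sup>2)"
      by (simp add: S2_def norm_mult)
    moreover have "(S1 1 z0)\<^sup>2 + (S1 \<i> z0)\<^sup>2
        = 4 * (norm (cnj (A z0) * deriv A z0 + cnj (B z0) * deriv B z0 + cnj (C z0) * deriv C z0))\<^sup>2"
      by (simp add: S1_def cmod_power2) (simp add: power2_eq_square algebra_simps)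
    moreover have "S z0 * (4 * ((norm (deriv A z0))\<^sup>2 + (norm (deriv B z0))\<^sup>2 + (norm (deriv C z0))\<^sup>2))
       - 4 * (norm (cnj (A z0) * deriv A z0 + cnj (B z0) * deriv B z0 + cnj (C z0) * deriv C z0))\<^sup>2
       \<ge> 4 * (k * S z0 ^ 3)"
      using lagrange_identity_3[of "A z0" "B z0" "C z0" "deriv A z0" "deriv B z0" "deriv C z0"] curv[of z0]
      unfolding S_def by (simp add: algebra_simps)
    ultimately have "4 * (k * S z0 ^ 3) * (q z0)\<^sup>2 \<le> 8 * R\<^sup>2 * (S z0)\<^sup>2"
      by (smt (verit) mult_right_mono zero_le_power2)
    hence "(4 * (S z0)\<^sup>2) * (k * (S z0 * (q z0)\<^sup>2)) \<le> (4 * (S z0)\<^sup>2) * (2 * R\<^sup>2)"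
      by (simp add: power3_eq_cube power2_eq_square algebra_simps)
    hence "k * (S z0 * (q z0)\<^sup>2) \<le> 2 * R\<^sup>2"
      using Spos by (subst (asm) mult_le_cancel_left_pos) auto
    moreover have "k * (S w * R ^ 4) \<le> k * (S z0 * (q z0)\<^sup>2)" using U0 k by simp
    ultimately have "R\<^sup>2 * (k * S w * R\<^sup>2) \<le> R\<^sup>2 * 2"
      by (simp add: power2_eq_square power4_eq_xxxx algebra_simps)
    thus ?thesis using R by (subst (asm) mult_le_cancel_left_pos) auto
  qed
  have "S w = 0"
  proof (rule ccontr)
    assume "S w \<noteq> 0"
    hence "S w > 0" by (smt (verit) S_def zero_le_power2)
    \<comment> \<open>This radius makes the left-hand side of \<open>bound\<close> equal to 3, above
      the permitted 2.\<close>
    hence "k * S w * (sqrt (3 / (k * S w)))\<^sup>2 = 3" "sqrt (3 / (k * S w)) > 0" using k by simp_all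
    thus False using bound by fastforce
  qed
  thus "A w = 0" "B w = 0" "C w = 0"
    by (simp_all add: S_def add_nonneg_eq_0_iff)
qed

subsection \<open>Estimates on the curve \<open>P(x) = c P(y)\<close>\<close>

text \<open>Powers of 1 + |x| in place of |x| make the growth estimates hold on the whole plane, not
  only for large x.\<close>

lemma norm_poly_le_power:
  fixes p :: "complex poly"
  assumes "degree p \<le> d"
  shows "\<exists>K>0. \<forall>x. norm (poly p x) \<le> K * (1 + norm x) ^ d"
proof (intro exI conjI allI)
  let ?K = "1 + (\<Sum>i\<le>degree p. norm (coeff p i))"
  show "?K > 0" by (smt (verit) norm_ge_zero sum_nonneg)
  fix x :: complex
  have "norm (poly p x) \<le> (\<Sum>i\<le>degree p. norm (coeff p i) * norm x ^ i)"
    unfolding poly_altdef by (rule order_trans[OF norm_sum]) (simp add: norm_mult norm_power)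
  also have "\<dots> \<le> (\<Sum>i\<le>degree p. norm (coeff p i) * (1 + norm x) ^ d)"
  proof (intro sum_mono mult_left_mono)
    fix i assume "i \<in> {..degree p}"
    have "norm x ^ i \<le> (1 + norm x) ^ i" by (intro power_mono) auto
    also have "\<dots> \<le> (1 + norm x) ^ d" using \<open>i \<in> _\<close> assms by (intro power_increasing) auto
    finally show "norm x ^ i \<le> (1 + norm x) ^ d" .
  qed auto
  also have "\<dots> = (\<Sum>i\<le>degree p. norm (coeff p i)) * (1 + norm x) ^ d" by (simp add: sum_distrib_right)
  also have "\<dots> \<le> ?K * (1 + norm x) ^ d" by (intro mult_right_mono) auto
  finally show "norm (poly p x) \<le> ?K * (1 + norm x) ^ d" .
qed

text \<open>For large x the leading term dominates; the additive constant \<open>K\<close> pays for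
  the bounded region, where \<open>p\<close> may vanish.\<close>

lemma norm_poly_ge_power:
  fixes p :: "complex poly"
  assumes "p \<noteq> 0"
  shows "\<exists>k>0. \<exists>K>0. \<forall>x. k * (1 + norm x) ^ degree p \<le> norm (poly p x) + K"
proof (cases "degree p")
  case 0
  show ?thesis by (rule exI[of _ 1], simp add: 0, rule exI[of _ 1]) simp
next
  case (Suc d)
  define r where "r = p - monom (lead_coeff p) (Suc d)"
  define l where "l = norm (lead_coeff p)"
  have l: "l > 0" using assms by (simp add: l_def)
  have "degree r \<le> d"
    by (rule degree_le) (auto simp: r_def Suc less_Suc_eq coeff_eq_0 dest: Suc_leI le_neq_implies_less)
  then obtain K where K: "K > 0" "\<And>x. norm (poly r x) \<le> K * (1 + norm x) ^ d"
    using norm_poly_le_power by blast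
  \<comment> \<open>For t = 1 + |x| > T, the error 2^(d+1) K t^d coming from \<open>r\<close> is at
    most half of l t^(d+1) and can be absorbed. The factor 2^(d+1) is the cost of replacing |x| by t
    in the leading term.\<close>
  define T where "T = 2 * 2 ^ Suc d * K / l"
  have T: "T \<ge> 0" using K l by (simp add: T_def)
  define k where "k = l / (2 * 2 ^ Suc d)"
  have k: "k > 0" using l by (simp add: k_def)
  have "k * (1 + norm x) ^ Suc d \<le> norm (poly p x) + (l + k * T ^ Suc d + 1)" for x
  proof (cases "1 + norm x \<le> T")
    case True
    have "(1 + norm x) ^ Suc d \<le> T ^ Suc d" using True by (intro power_mono) auto
    hence "k * (1 + norm x) ^ Suc d \<le> k * T ^ Suc d" using k by (intro mult_left_mono) auto
    thus ?thesis using l by (smt (verit) norm_ge_zero)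
  next
    case False
    let ?t = "1 + norm x"
    have t: "?t ^ Suc d \<le> 2 ^ Suc d * (norm x ^ Suc d + 1)"
    proof (cases "norm x \<ge> 1")
      case True
      have "?t ^ Suc d \<le> (2 * norm x) ^ Suc d" using True by (intro power_mono) auto
      also have "\<dots> = 2 ^ Suc d * norm x ^ Suc d" by (rule power_mult_distrib)
      also have "\<dots> \<le> 2 ^ Suc d * (norm x ^ Suc d + 1)" by (intro mult_left_mono) auto
      finally show ?thesis .
    next
      case False
      hence "?t ^ Suc d \<le> 2 ^ Suc d" by (intro power_mono) auto
      also have "\<dots> \<le> 2 ^ Suc d * (norm x ^ Suc d + 1)" by (simp add: algebra_simps)
      finally show ?thesis .
    qed
    have "poly p x = lead_coeff p * x ^ Suc d + poly r x" by (simp add: r_def poly_monom)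
    hence "l * norm x ^ Suc d \<le> norm (poly p x) + norm (poly r x)"
      by (metis add_diff_cancel_right' l_def norm_mult norm_power norm_triangle_ineq4)
    hence 1: "l * norm x ^ Suc d \<le> norm (poly p x) + K * ?t ^ d" using K(2)[of x] by linarith
    have "l * T \<le> l * ?t" using False l by (intro mult_left_mono) auto
    hence "2 * 2 ^ Suc d * K \<le> l * ?t" using l by (simp add: T_def)
    hence "2 * 2 ^ Suc d * K * ?t ^ d \<le> l * ?t * ?t ^ d" by (intro mult_right_mono) auto
    hence 2: "2 * 2 ^ Suc d * (K * ?t ^ d) \<le> l * ?t ^ Suc d" by (simp add: mult_ac)
    have "l * ?t ^ Suc d \<le> l * (2 ^ Suc d * (norm x ^ Suc d + 1))" using t l by (intro mult_left_mono) auto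
    also have "\<dots> = 2 ^ Suc d * (l * norm x ^ Suc d + l)" by (simp only: algebra_simps)
    also have "\<dots> \<le> 2 ^ Suc d * (norm (poly p x) + K * ?t ^ d + l)" using 1 by (intro mult_left_mono) auto
    finally have "2 * (l * ?t ^ Suc d) \<le> 2 * 2 ^ Suc d * (norm (poly p x) + l) + l * ?t ^ Suc d"
      using 2 by (simp add: algebra_simps)
    hence "l * ?t ^ Suc d \<le> 2 * 2 ^ Suc d * (norm (poly p x) + l)" by linarith
    hence "k * ?t ^ Suc d \<le> norm (poly p x) + l" by (simp add: k_def divide_simps mult_ac)
    thus ?thesis using k T by (smt (verit) mult_nonneg_nonneg zero_le_power)
  qed
  moreover have "l + k * T ^ Suc d + 1 > 0" using l k T by (intro add_nonneg_pos add_nonneg_nonneg) auto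
  ultimately show ?thesis using k Suc by metis
qed

text \<open>Both sides of P(x) = c P(y) grow like n-th powers, so n-th roots can be compared. Used
  with \<open>c\<close> and with \<open>inverse c\<close>, this shows that f and g have the same
  poles.\<close>

lemma comparable_of_poly_eq:
  fixes P :: "complex poly"
  assumes "degree P > 0"
  shows "\<exists>L\<ge>1. \<forall>x y. poly P x = c * poly P y \<longrightarrow> 1 + norm x \<le> L * (1 + norm y)"
proof -
  let ?n = "degree P"
  have "P \<noteq> 0" using assms by auto
  then obtain k K where k: "k > 0" "K > 0" "\<And>x. k * (1 + norm x) ^ ?n \<le> norm (poly P x) + K"
    using norm_poly_ge_power by metis
  obtain M where M: "M > 0" "\<And>x. norm (poly P x) \<le> M * (1 + norm x) ^ ?n"
    using norm_poly_le_power[of P ?n] by blast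
  \<comment> \<open>The maximum with 1 ensures that L is at most L^n, so that the constant can be
    moved inside the n-th power.\<close>
  define L where "L = max 1 ((norm c * M + K) / k)"
  have L: "L \<ge> 1" by (simp add: L_def)
  have "1 + norm x \<le> L * (1 + norm y)" if "poly P x = c * poly P y" for x y
  proof -
    let ?t = "1 + norm x" and ?s = "1 + norm y"
    have s: "1 \<le> ?s ^ ?n" by (rule one_le_power) simp
    have "k * ?t ^ ?n \<le> norm c * norm (poly P y) + K" using k(3)[of x] that by (simp add: norm_mult)
    also have "\<dots> \<le> norm c * (M * ?s ^ ?n) + K * ?s ^ ?n"
      using M k(2) s by (intro add_mono mult_left_mono) auto
    also have "\<dots> = (norm c * M + K) * ?s ^ ?n" by (simp add: algebra_simps)
    finally have "?t ^ ?n \<le> (norm c * M + K) / k * ?s ^ ?n" using k(1) by (simp add: field_simps)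
    also have "\<dots> \<le> L * ?s ^ ?n" using s by (intro mult_right_mono) (auto simp: L_def)
    also have "\<dots> \<le> L ^ ?n * ?s ^ ?n" using L assms s by (intro mult_right_mono self_le_power) auto
    finally have "?t ^ ?n \<le> (L * ?s) ^ ?n" by (simp add: power_mult_distrib)
    thus ?thesis using assms L by (subst (asm) power_mono_iff) auto
  qed
  thus ?thesis using L by blast
qed

text \<open>Euler's relation for the homogenisation of \<open>P\<close>: \<open>E = X P' - n P\<close> has lost the top term, so it
  has degree at most \<open>m\<close>, and \<open>w P'(x) = y' (E(x) - c E(y))\<close> on the curve \<open>P(x) = c P(y)\<close>. This makes
  \<open>w\<close> small compared with \<open>y'\<close> near infinity.\<close>

lemma wronskian_bound:
  fixes P :: "complex poly"
  assumes gap: "\<And>i. m < i \<Longrightarrow> i < degree P \<Longrightarrow> coeff P i = 0" and n: "m + Suc d \<le> degree P" and c: "c \<noteq> 0"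
  shows "\<exists>K\<ge>1. \<forall>x y x' y'. poly P x = c * poly P y \<longrightarrow> poly (pderiv P) x * x' = c * poly (pderiv P) y * y' \<longrightarrow>
    norm (x * y' - x' * y) * (1 + norm x) ^ d \<le> K * (norm y' + norm (x * y' - x' * y))"
proof -
  let ?n = "degree P"
  define E where "E = pCons 0 (pderiv P) - smult (of_nat ?n) P"
  have "coeff E i = (of_nat i - of_nat ?n) * coeff P i" for i
    by (cases i) (simp_all add: E_def coeff_pderiv algebra_simps)
  hence "degree E \<le> m" using gap by (intro degree_le) (auto, metis coeff_eq_0 linorder_neqE_nat)
  then obtain K1 where K1: "K1 > 0" "\<And>x. norm (poly E x) \<le> K1 * (1 + norm x) ^ m"
    using norm_poly_le_power by blast
  have "pderiv P \<noteq> 0" using n by (auto simp: pderiv_eq_0_iff)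
  then obtain k K where k: "k > 0" "K > 0" "\<And>x. k * (1 + norm x) ^ degree (pderiv P) \<le> norm (poly (pderiv P) x) + K"
    using norm_poly_ge_power by metis
  have dP: "degree (pderiv P) = ?n - 1" by (rule degree_pderiv)
  obtain L where L: "L \<ge> 1" "\<And>x y. poly P x = inverse c * poly P y \<Longrightarrow> 1 + norm x \<le> L * (1 + norm y)"
    using comparable_of_poly_eq[of P "inverse c"] n by auto
  define K2 where "K2 = K1 + norm c * K1 * L ^ m"
  have K2: "K2 > 0" using K1 L by (simp add: K2_def add_pos_nonneg)
  define K3 where "K3 = 1 + (K2 + K) / k"
  have "norm (x * y' - x' * y) * (1 + norm x) ^ d \<le> K3 * (norm y' + norm (x * y' - x' * y))"
    if eq: "poly P x = c * poly P y" and eq': "poly (pderiv P) x * x' = c * poly (pderiv P) y * y'" for x y x' y'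
  proof -
    let ?w = "x * y' - x' * y" and ?t = "1 + norm x"
    have s: "1 + norm y \<le> L * ?t" using eq c by (intro L(2)) simp
    \<comment> \<open>The relation between the derivatives replaces x' P'(x) by c y' P'(y); then y'
      times n (P(x) - c P(y)) = 0 is subtracted to pass from X P' to \<open>E\<close>.\<close>
    have "?w * poly (pderiv P) x = y' * (poly E x - c * poly E y)"
      using eq eq' unfolding E_def by simp algebra
    hence "norm ?w * norm (poly (pderiv P) x) = norm y' * norm (poly E x - c * poly E y)"
      by (metis norm_mult)
    also have "\<dots> \<le> norm y' * (K2 * ?t ^ m)"
    proof (rule mult_left_mono)
      have "norm (poly E x - c * poly E y) \<le> norm (poly E x) + norm c * norm (poly E y)"
        by (metis norm_mult norm_triangle_ineq4)
      also have "\<dots> \<le> K1 * ?t ^ m + norm c * (K1 * (L * ?t) ^ m)"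
      proof (intro add_mono mult_left_mono K1)
        have "norm (poly E y) \<le> K1 * (1 + norm y) ^ m" by (rule K1)
        also have "\<dots> \<le> K1 * (L * ?t) ^ m" using s K1 by (intro mult_left_mono power_mono) auto
        finally show "norm (poly E y) \<le> K1 * (L * ?t) ^ m" .
      qed auto
      also have "\<dots> = K2 * ?t ^ m" unfolding K2_def power_mult_distrib by (simp add: algebra_simps)
      finally show "norm (poly E x - c * poly E y) \<le> K2 * ?t ^ m" .
    qed auto
    finally have 1: "norm ?w * norm (poly (pderiv P) x) \<le> norm y' * (K2 * ?t ^ m)" .
    have t1: "1 \<le> ?t ^ m" by (rule one_le_power) simp
    \<comment> \<open>P' has degree n - 1 >= m + d, while the right-hand side of the previous bound
      grows only like t^m apart from y'. Cancelling t^m leaves the d powers of t.\<close>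
    have "k * (norm ?w * ?t ^ d) * ?t ^ m = norm ?w * (k * ?t ^ (m + d))" by (simp add: power_add mult_ac)
    also have "\<dots> \<le> norm ?w * (k * ?t ^ (?n - 1))"
      using n k by (intro mult_left_mono power_increasing) auto
    also have "\<dots> \<le> norm ?w * (norm (poly (pderiv P) x) + K)"
      using k(3)[of x] dP by (intro mult_left_mono) auto
    also have "\<dots> \<le> norm y' * (K2 * ?t ^ m) + norm ?w * K"
      using 1 by (simp add: algebra_simps)
    also have "\<dots> \<le> norm y' * (K2 * ?t ^ m) + norm ?w * K * ?t ^ m"
      using mult_left_mono[OF t1, of "norm ?w * K"] k by simp
    also have "\<dots> = (norm y' * K2 + norm ?w * K) * ?t ^ m" by (simp add: algebra_simps)
    finally have "k * (norm ?w * ?t ^ d) \<le> norm y' * K2 + norm ?w * K"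
      by (rule mult_right_le_imp_le) (use t1 in linarith)
    also have "\<dots> \<le> (K2 + K) * (norm y' + norm ?w)" using K2 k by (simp add: algebra_simps)
    finally have "norm ?w * ?t ^ d \<le> (K2 + K) / k * (norm y' + norm ?w)" using k(1) by (simp add: field_simps)
    also have "\<dots> \<le> K3 * (norm y' + norm ?w)" by (intro mult_right_mono) (auto simp: K3_def)
    finally show ?thesis .
  qed
  moreover have "K3 \<ge> 1" using K2 k by (simp add: K3_def)
  ultimately show ?thesis by blast
qed

text \<open>Here n - m >= 4 enters: \<open>wronskian_bound\<close> with d = 3, once squared,
  supplies the sixth power of 1 + |x|, which matches the cube of 1 + |x|^2 + |y|^2. Multiplied by
  |w|^4, this becomes the curvature hypothesis for the triple w, w x, w y.\<close>

lemma curvature_bound: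
  fixes P :: "complex poly"
  assumes gap: "\<And>i. m < i \<Longrightarrow> i < degree P \<Longrightarrow> coeff P i = 0" and n: "m + 4 \<le> degree P" and c: "c \<noteq> 0"
  shows "\<exists>k>0. \<forall>x y x' y'. poly P x = c * poly P y \<longrightarrow> poly (pderiv P) x * x' = c * poly (pderiv P) y * y' \<longrightarrow>
    k * (norm (x * y' - x' * y))\<^sup>2 * (1 + (norm x)\<^sup>2 + (norm y)\<^sup>2) ^ 3
      \<le> (norm x')\<^sup>2 + (norm y')\<^sup>2 + (norm (x * y' - x' * y))\<^sup>2"
proof -
  obtain K where K: "K \<ge> 1" "\<And>x y x' y'. poly P x = c * poly P y \<Longrightarrow> poly (pderiv P) x * x' = c * poly (pderiv P) y * y' \<Longrightarrow>
    norm (x * y' - x' * y) * (1 + norm x) ^ 3 \<le> K * (norm y' + norm (x * y' - x' * y))"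
    using wronskian_bound[OF gap, of m 3 c] n c by auto
  obtain L where L: "L \<ge> 1" "\<And>x y. poly P x = inverse c * poly P y \<Longrightarrow> 1 + norm x \<le> L * (1 + norm y)"
    using comparable_of_poly_eq[of P "inverse c"] n by auto
  define k where "k = 1 / (2 * K\<^sup>2 * (1 + L\<^sup>2) ^ 3)"
  have Lp: "(1 + L\<^sup>2) ^ 3 > 0" by (intro zero_less_power add_pos_nonneg) auto
  have k: "k > 0" using K Lp by (simp add: k_def)
  have "k * (norm (x * y' - x' * y))\<^sup>2 * (1 + (norm x)\<^sup>2 + (norm y)\<^sup>2) ^ 3
      \<le> (norm x')\<^sup>2 + (norm y')\<^sup>2 + (norm (x * y' - x' * y))\<^sup>2"
    if eq: "poly P x = c * poly P y" and eq': "poly (pderiv P) x * x' = c * poly (pderiv P) y * y'" for x y x' y'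
  proof -
    let ?w = "x * y' - x' * y" and ?t = "1 + norm x"
    have s: "1 + norm y \<le> L * ?t" using eq c by (intro L(2)) simp
    have "1 + (norm x)\<^sup>2 \<le> ?t\<^sup>2" by (simp add: power2_eq_square algebra_simps)
    moreover have "(norm y)\<^sup>2 \<le> (L * ?t)\<^sup>2" using s by (intro power_mono) auto
    ultimately have "1 + (norm x)\<^sup>2 + (norm y)\<^sup>2 \<le> (1 + L\<^sup>2) * ?t\<^sup>2"
      by (simp add: power_mult_distrib distrib_right)
    hence "(1 + (norm x)\<^sup>2 + (norm y)\<^sup>2) ^ 3 \<le> ((1 + L\<^sup>2) * ?t\<^sup>2) ^ 3"
      by (intro power_mono) auto
    also have "\<dots> = (1 + L\<^sup>2) ^ 3 * (?t ^ 3)\<^sup>2" by (simp add: power_mult_distrib flip: power_mult)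
    finally have "k * (norm ?w)\<^sup>2 * (1 + (norm x)\<^sup>2 + (norm y)\<^sup>2) ^ 3 \<le> k * (norm ?w)\<^sup>2 * ((1 + L\<^sup>2) ^ 3 * (?t ^ 3)\<^sup>2)"
      using k by (intro mult_left_mono) auto
    also have "\<dots> = (norm ?w * ?t ^ 3)\<^sup>2 / (2 * K\<^sup>2)"
      using Lp by (simp add: k_def power_mult_distrib)
    also have "\<dots> \<le> (K * (norm y' + norm ?w))\<^sup>2 / (2 * K\<^sup>2)"
      using K(2)[OF eq eq'] by (intro divide_right_mono power_mono) auto
    also have "\<dots> = (norm y' + norm ?w)\<^sup>2 / 2" using K by (simp add: power_mult_distrib)
    also have "\<dots> \<le> (norm y')\<^sup>2 + (norm ?w)\<^sup>2"
      using zero_le_power2[of "norm y' - norm ?w"] by (simp add: power2_eq_square algebra_simps)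
    finally show ?thesis by (smt (verit) zero_le_power2)
  qed
  thus ?thesis using k by blast
qed

subsection \<open>Meromorphic solutions\<close>

lemma locally_bounded_of_analytic:
  fixes h :: "complex \<Rightarrow> complex"
  assumes "h analytic_on {z}"
  shows "\<exists>B. \<forall>\<^sub>F x in at z. norm (h x) \<le> B"
proof -
  have "(h \<longlongrightarrow> h z) (at z)" using assms analytic_at_imp_isCont isContD by blast
  hence "((\<lambda>x. norm (h x)) \<longlongrightarrow> norm (h z)) (at z)" by (rule tendsto_norm)
  hence "\<forall>\<^sub>F x in at z. norm (h x) < norm (h z) + 1" by (rule order_tendstoD) simp
  thus ?thesis by (intro exI[of _ "norm (h z) + 1"]) (auto elim: eventually_mono)
qed

lemma is_pole_imp_eventually_norm_gt:
  assumes "is_pole h z"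
  shows "\<forall>\<^sub>F x in at z. norm (h x) > B"
  using filterlim_at_infinity_imp_norm_at_top assms unfolding is_pole_def filterlim_at_top_dense by blast

lemma not_pole_of_locally_bounded:
  fixes h :: "complex \<Rightarrow> complex"
  assumes "\<forall>\<^sub>F x in at z. norm (h x) \<le> B"
  shows "\<not> is_pole h z"
proof
  assume "is_pole h z"
  hence "\<forall>\<^sub>F x in at z. norm (h x) > B" by (rule is_pole_imp_eventually_norm_gt)
  with assms have "\<forall>\<^sub>F x in at z. False" by eventually_elim auto
  thus False by simp
qed

lemma is_pole_of_norm_le:
  fixes f g :: "complex \<Rightarrow> complex"
  assumes g: "g nicely_meromorphic_on UNIV" and f: "is_pole f z" and L: "1 \<le> L"
    and le: "\<forall>\<^sub>F x in at z. 1 + norm (f x) \<le> L * (1 + norm (g x))"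
  shows "is_pole g z"
proof (rule ccontr)
  assume "\<not> is_pole g z"
  then obtain B where "\<forall>\<^sub>F x in at z. norm (g x) \<le> B"
    using locally_bounded_of_analytic nicely_meromorphic_on_imp_analytic_at[OF g] by blast
  with le have "\<forall>\<^sub>F x in at z. norm (f x) \<le> L * (1 + B)"
  proof eventually_elim
    case (elim x)
    have "L * (1 + norm (g x)) \<le> L * (1 + B)" using elim L by (intro mult_left_mono) auto
    thus ?case using elim by linarith
  qed
  thus False using f not_pole_of_locally_bounded by blast
qed

lemma remove_sings_entire:
  assumes "h meromorphic_on UNIV" "\<And>z. \<exists>B. \<forall>\<^sub>F x in at z. norm (h x) \<le> B"
  shows "remove_sings h holomorphic_on UNIV"
proof -
  have "\<not> is_pole (remove_sings h) z" for z
  proof -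
    obtain B where "\<forall>\<^sub>F x in at z. norm (h x) \<le> B" using assms(2) by blast
    moreover have "\<forall>\<^sub>F x in at z. remove_sings h x = h x"
      using assms(1) eventually_remove_sings_eq eventually_cosparse_imp_eventually_at by blast
    ultimately have "\<forall>\<^sub>F x in at z. norm (remove_sings h x) \<le> B" by eventually_elim simp
    thus ?thesis by (rule not_pole_of_locally_bounded)
  qed
  hence "remove_sings h analytic_on UNIV"
    using remove_sings_nicely_meromorphic[OF assms(1)] nicely_meromorphic_without_singularities by blast
  thus ?thesis by (rule analytic_imp_holomorphic)
qed

text \<open>The curvature inequality is computed only where f and g are analytic; continuity carries
  it to the remaining points.\<close>

lemma le_everywhere_of_le_cosparse:
  fixes F G :: "complex \<Rightarrow> real"
  assumes "\<forall>\<^sub>\<approx>z. F z \<le> G z" "continuous_on UNIV F" "continuous_on UNIV G"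
  shows "F z \<le> G z"
proof -
  have "\<forall>\<^sub>F x in at z. F x \<le> G x" using assms(1) eventually_cosparse_imp_eventually_at by blast
  moreover have "(F \<longlongrightarrow> F z) (at z)" "(G \<longlongrightarrow> G z) (at z)"
    using assms(2,3) by (auto simp: continuous_on_def)
  ultimately show ?thesis using tendsto_le[of "at z" G "G z" F "F z"] by simp
qed

lemma deriv_eq_of_poly_eq:
  fixes P :: "complex poly"
  assumes an: "f analytic_on {z}" "g analytic_on {z}" and eq: "\<forall>\<^sub>F x in nhds z. poly P (f x) = c * poly P (g x)"
  shows "poly (pderiv P) (f z) * deriv f z = c * poly (pderiv P) (g z) * deriv g z"
proof -
  have 1: "((\<lambda>x. poly P (f x)) has_field_derivative poly (pderiv P) (f z) * deriv f z) (at z)"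
    by (rule DERIV_chain2[OF poly_DERIV analytic_derivI[OF an(1)]])
  have 2: "((\<lambda>x. c * poly P (g x)) has_field_derivative c * (poly (pderiv P) (g z) * deriv g z)) (at z)"
    by (rule DERIV_cmult[OF DERIV_chain2[OF poly_DERIV analytic_derivI[OF an(2)]]])
  show ?thesis using deriv_cong_ev[OF eq refl] DERIV_imp_deriv[OF 1] DERIV_imp_deriv[OF 2] by (simp add: mult.assoc)
qed

text \<open>The triple w (1, f, g) is chosen because its 2 x 2 minors with its derivative are w^2
  f', w^2 g' and w^3, exactly the quantities bounded below by \<open>curvature_bound\<close>. What
  remains is to see that the triple stays bounded at the common poles of f and g.\<close>

lemma meromorphic_wronskian_eq_0:
  fixes P :: "complex poly" and f g :: "complex \<Rightarrow> complex"
  assumes gap: "\<And>i. m < i \<Longrightarrow> i < degree P \<Longrightarrow> coeff P i = 0" and n: "m + 4 \<le> degree P" and c: "c \<noteq> 0"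
    and mer: "f nicely_meromorphic_on UNIV" "g nicely_meromorphic_on UNIV"
    and eq: "\<forall>\<^sub>\<approx>z. poly P (f z) = c * poly P (g z)"
  shows "\<forall>\<^sub>\<approx>z. f z * deriv g z - deriv f z * g z = 0"
proof -
  have mer': "f meromorphic_on UNIV" "g meromorphic_on UNIV"
    using mer by (auto simp: nicely_meromorphic_on_def)
  define good where "good = (\<lambda>z. f analytic_on {z} \<and> g analytic_on {z} \<and> poly P (f z) = c * poly P (g z))"
  have ev_good: "\<forall>\<^sub>\<approx>z. good z"
    unfolding good_def by (intro eventually_conj meromorphic_on_imp_analytic_cosparse mer' eq)
  have at_good: "\<forall>\<^sub>F x in at z. good x" for z
    using ev_good eventually_cosparse_imp_eventually_at by blast
  have diff: "poly (pderiv P) (f z) * deriv f z = c * poly (pderiv P) (g z) * deriv g z" if "good z" for z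
  proof (rule deriv_eq_of_poly_eq)
    show "\<forall>\<^sub>F x in nhds z. poly P (f x) = c * poly P (g x)"
      using that at_good[of z] by (auto simp: good_def eventually_nhds_conv_at elim: eventually_mono)
  qed (use that in \<open>auto simp: good_def\<close>)
  define w where "w = (\<lambda>z. f z * deriv g z - deriv f z * g z)"
  have merw: "w meromorphic_on UNIV" unfolding w_def by (intro meromorphic_intros mer')
  obtain K where K: "K \<ge> 1" "\<And>x y x' y'. poly P x = c * poly P y \<Longrightarrow> poly (pderiv P) x * x' = c * poly (pderiv P) y * y' \<Longrightarrow>
    norm (x * y' - x' * y) * (1 + norm x) ^ 3 \<le> K * (norm y' + norm (x * y' - x' * y))"
    using wronskian_bound[OF gap, of m 3 c] n c by auto
  obtain L where L: "L \<ge> 1" "\<And>x y. poly P x = inverse c * poly P y \<Longrightarrow> 1 + norm x \<le> L * (1 + norm y)"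
    using comparable_of_poly_eq[of P "inverse c"] n by auto
  obtain L' where L': "L' \<ge> 1" "\<And>x y. poly P x = c * poly P y \<Longrightarrow> 1 + norm x \<le> L' * (1 + norm y)"
    using comparable_of_poly_eq[of P c] n by auto
  have cmp: "1 + norm (g z) \<le> L * (1 + norm (f z))" "1 + norm (f z) \<le> L' * (1 + norm (g z))" if "good z" for z
    using that c by (auto simp: good_def intro!: L(2) L'(2))
  have poles: "is_pole f z \<longleftrightarrow> is_pole g z" for z
    using is_pole_of_norm_le[OF mer(2) _ L'(1)] is_pole_of_norm_le[OF mer(1) _ L(1)] at_good[of z] cmp
    by (metis (mono_tags, lifting) eventually_mono)
  have bdd: "(\<exists>B. \<forall>\<^sub>F x in at z. norm (w x) \<le> B) \<and> (\<exists>B. \<forall>\<^sub>F x in at z. norm (w x * f x) \<le> B)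
    \<and> (\<exists>B. \<forall>\<^sub>F x in at z. norm (w x * g x) \<le> B)" for z
  proof (cases "is_pole f z")
    case False
    hence "f analytic_on {z}" "g analytic_on {z}"
      using poles mer nicely_meromorphic_on_imp_analytic_at by blast+
    thus ?thesis unfolding w_def
      by (intro conjI locally_bounded_of_analytic analytic_intros)
  next
    case f: True
    hence g: "is_pole g z" using poles by blast
    \<comment> \<open>At a pole of g, v = 1/g is analytic and g' = -g^2 v', so g' is O(t^2) for t =
      1 + |f|. Since w t^3 is O(g'), w t is bounded, hence so are w, w f and w g.\<close>
    define v where "v = (\<lambda>x. inverse (g x))"
    have "v nicely_meromorphic_on UNIV" unfolding v_def by (intro nicely_meromorphic_on_inverse mer)
    moreover have "\<not> is_pole v z"
    proof (rule not_pole_of_locally_bounded)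
      show "\<forall>\<^sub>F x in at z. norm (v x) \<le> 1"
        using is_pole_imp_eventually_norm_gt[OF g, of 1]
        by eventually_elim (simp add: v_def norm_inverse inverse_le_1_iff)
    qed
    ultimately have "v analytic_on {z}" using nicely_meromorphic_on_imp_analytic_at by blast
    hence "deriv v analytic_on {z}" by (rule analytic_deriv)
    then obtain B where B: "\<forall>\<^sub>F x in at z. norm (deriv v x) \<le> B"
      using locally_bounded_of_analytic by blast
    have main: "\<forall>\<^sub>F x in at z. norm (w x) * (1 + norm (f x)) \<le> 2 * K * L\<^sup>2 * B"
      using at_good[of z] B is_pole_imp_eventually_norm_gt[OF g, of 1] is_pole_imp_eventually_norm_gt[OF f, of "2 * K"]
    proof eventually_elim
      case (elim x)
      let ?t = "1 + norm (f x)"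
      have "g x \<noteq> 0" using elim by auto
      moreover have "(g has_field_derivative deriv g x) (at x)" using elim by (intro analytic_derivI) (simp add: good_def)
      ultimately have "(v has_field_derivative - (inverse (g x) * deriv g x * inverse (g x))) (at x)"
        unfolding v_def by (intro DERIV_inverse') auto
      hence "deriv v x = - (inverse (g x) * deriv g x * inverse (g x))" by (rule DERIV_imp_deriv)
      hence "deriv g x = - ((g x)\<^sup>2 * deriv v x)"
        using \<open>g x \<noteq> 0\<close> by (simp add: power2_eq_square field_simps)
      hence dv: "norm (deriv g x) = (norm (g x))\<^sup>2 * norm (deriv v x)"
        by (metis norm_minus_cancel norm_mult norm_power)
      \<comment> \<open>Close to the pole, t is at least 2 K, so the term K |w| in the bound on |w|
        t^3 is at most half of the left-hand side and can be absorbed.\<close>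
      have "2 * K \<le> ?t" using elim by simp
      also have "\<dots> \<le> ?t ^ 3" by (rule self_le_power) auto
      finally have "norm (w x) * (2 * K) \<le> norm (w x) * ?t ^ 3" by (intro mult_left_mono) auto
      moreover have "norm (w x) * ?t ^ 3 \<le> K * (norm (deriv g x) + norm (w x))"
        unfolding w_def using diff[OF elim(1)] elim(1) by (intro K(2)) (auto simp: good_def)
      ultimately have "norm (w x) * ?t ^ 3 \<le> 2 * K * norm (deriv g x)" by (simp add: algebra_simps)
      also have "\<dots> \<le> 2 * K * ((L * ?t)\<^sup>2 * B)"
        unfolding dv using cmp(1)[OF elim(1)] elim(2) K(1)
        by (intro mult_left_mono mult_mono power_mono) auto
      finally have "(norm (w x) * ?t) * ?t\<^sup>2 \<le> (2 * K * L\<^sup>2 * B) * ?t\<^sup>2"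
        by (simp only: power_mult_distrib power2_eq_square power3_eq_cube mult_ac)
      moreover have "?t\<^sup>2 > 0" by (intro zero_less_power add_pos_nonneg) auto
      ultimately show ?case by (rule mult_right_le_imp_le)
    qed
    have "\<forall>\<^sub>F x in at z. norm (w x) \<le> 2 * K * L\<^sup>2 * B"
      using main by eventually_elim (simp add: distrib_left, smt (verit) mult_nonneg_nonneg norm_ge_zero)
    moreover have "\<forall>\<^sub>F x in at z. norm (w x * f x) \<le> 2 * K * L\<^sup>2 * B"
      using main by eventually_elim (simp add: norm_mult distrib_left, smt (verit) norm_ge_zero)
    moreover have "\<forall>\<^sub>F x in at z. norm (w x * g x) \<le> L * (2 * K * L\<^sup>2 * B)"
      using main at_good[of z]
    proof eventually_elim
      case (elim x)
      have "norm (w x * g x) \<le> norm (w x) * (L * (1 + norm (f x)))"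
        unfolding norm_mult using cmp(1)[OF elim(2)] by (intro mult_left_mono) auto
      also have "\<dots> = L * (norm (w x) * (1 + norm (f x)))" by (simp add: mult_ac)
      also have "\<dots> \<le> L * (2 * K * L\<^sup>2 * B)" using elim L by (intro mult_left_mono) auto
      finally show ?case .
    qed
    ultimately show ?thesis by blast
  qed
  define A where "A = remove_sings w"
  define B where "B = remove_sings (\<lambda>z. w z * f z)"
  define C where "C = remove_sings (\<lambda>z. w z * g z)"
  have hol: "A holomorphic_on UNIV" "B holomorphic_on UNIV" "C holomorphic_on UNIV"
    unfolding A_def B_def C_def using bdd by (intro remove_sings_entire meromorphic_intros merw mer'; blast)+
  obtain k where k: "k > 0" "\<And>x y x' y'. poly P x = c * poly P y \<Longrightarrow> poly (pderiv P) x * x' = c * poly (pderiv P) y * y' \<Longrightarrow>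
    k * (norm (x * y' - x' * y))\<^sup>2 * (1 + (norm x)\<^sup>2 + (norm y)\<^sup>2) ^ 3
      \<le> (norm x')\<^sup>2 + (norm y')\<^sup>2 + (norm (x * y' - x' * y))\<^sup>2"
    using curvature_bound[OF gap n c] by auto
  have curv_good: "\<forall>\<^sub>\<approx>z. k * ((norm (A z))\<^sup>2 + (norm (B z))\<^sup>2 + (norm (C z))\<^sup>2) ^ 3 \<le>
      (norm (A z * deriv B z - deriv A z * B z))\<^sup>2 + (norm (A z * deriv C z - deriv A z * C z))\<^sup>2
      + (norm (B z * deriv C z - deriv B z * C z))\<^sup>2"
      using ev_good
    proof eventually_elim
      case (elim z)
      have an: "f analytic_on {z}" "g analytic_on {z}" using elim by (auto simp: good_def)
      hence anw: "w analytic_on {z}" unfolding w_def by (intro analytic_intros)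
      have vals: "A z = w z" "B z = w z * f z" "C z = w z * g z"
        unfolding A_def B_def C_def by (intro remove_sings_at_analytic analytic_intros an anw)+
      have d: "deriv A z = deriv w z" "deriv B z = deriv w z * f z + w z * deriv f z"
        "deriv C z = deriv w z * g z + w z * deriv g z"
      proof -
        show "deriv A z = deriv w z" unfolding A_def by (intro deriv_remove_sings_at_analytic anw)
        have "deriv B z = deriv (\<lambda>z. w z * f z) z"
          unfolding B_def by (intro deriv_remove_sings_at_analytic analytic_intros anw an)
        also have "\<dots> = deriv w z * f z + w z * deriv f z"
          by (rule DERIV_imp_deriv) (rule derivative_eq_intros analytic_derivI anw an refl | simp)+
        finally show "deriv B z = deriv w z * f z + w z * deriv f z" .
        have "deriv C z = deriv (\<lambda>z. w z * g z) z"
          unfolding C_def by (intro deriv_remove_sings_at_analytic analytic_intros anw an)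
        also have "\<dots> = deriv w z * g z + w z * deriv g z"
          by (rule DERIV_imp_deriv) (rule derivative_eq_intros analytic_derivI anw an refl | simp)+
        finally show "deriv C z = deriv w z * g z + w z * deriv g z" .
      qed
      have W: "A z * deriv B z - deriv A z * B z = (w z)\<^sup>2 * deriv f z"
        "A z * deriv C z - deriv A z * C z = (w z)\<^sup>2 * deriv g z"
        "B z * deriv C z - deriv B z * C z = (w z)\<^sup>2 * w z"
        unfolding vals d w_def by (simp_all add: power2_eq_square algebra_simps)
      have "k * ((norm (A z))\<^sup>2 + (norm (B z))\<^sup>2 + (norm (C z))\<^sup>2) ^ 3
        = k * ((norm (w z))\<^sup>2 * (1 + (norm (f z))\<^sup>2 + (norm (g z))\<^sup>2)) ^ 3"
        by (simp add: vals norm_mult power_mult_distrib distrib_left)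
      also have "\<dots> = (norm (w z)) ^ 4 * (k * (norm (w z))\<^sup>2 * (1 + (norm (f z))\<^sup>2 + (norm (g z))\<^sup>2) ^ 3)"
        by (simp add: power_mult_distrib flip: power_mult power_add)
      also have "\<dots> \<le> (norm (w z)) ^ 4 * ((norm (deriv f z))\<^sup>2 + (norm (deriv g z))\<^sup>2 + (norm (w z))\<^sup>2)"
        unfolding w_def using elim diff[OF elim] by (intro mult_left_mono k(2)) (auto simp: good_def)
      also have "\<dots> = (norm ((w z)\<^sup>2 * deriv f z))\<^sup>2 + (norm ((w z)\<^sup>2 * deriv g z))\<^sup>2 + (norm ((w z)\<^sup>2 * w z))\<^sup>2"
        by (simp add: norm_mult norm_power power_mult_distrib distrib_left flip: power_mult)
      finally show ?case unfolding W .
    qed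
  have curv: "k * ((norm (A z))\<^sup>2 + (norm (B z))\<^sup>2 + (norm (C z))\<^sup>2) ^ 3 \<le>
      (norm (A z * deriv B z - deriv A z * B z))\<^sup>2 + (norm (A z * deriv C z - deriv A z * C z))\<^sup>2
      + (norm (B z * deriv C z - deriv B z * C z))\<^sup>2" for z
    by (rule le_everywhere_of_le_cosparse[OF curv_good])
       (intro continuous_intros holomorphic_on_imp_continuous_on hol holomorphic_deriv open_UNIV)+
  have "A z = 0" for z by (rule negatively_curved_entire_triple_eq_0(1)[OF hol k(1) curv])
  moreover have "\<forall>\<^sub>\<approx>z. remove_sings w z = w z" by (rule eventually_remove_sings_eq[OF merw])
  ultimately show ?thesis unfolding A_def by (auto simp: w_def)
qed

text \<open>The derivative of f/g is -w/g^2 = 0, so f/g is constant on some disc. A meromorphic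
  function on the plane takes a given value either almost everywhere or almost nowhere, in the
  cosparse sense, which spreads the constant to the plane.\<close>

lemma meromorphic_proportional_of_wronskian_eq_0:
  assumes mer: "f meromorphic_on UNIV" "g meromorphic_on UNIV"
    and w: "\<forall>\<^sub>\<approx>z. f z * deriv g z - deriv f z * g z = 0" and g: "\<not> (\<forall>\<^sub>\<approx>z. g z = 0)"
  shows "\<exists>c. \<forall>\<^sub>\<approx>z. f z = c * g z"
proof -
  define h where "h = (\<lambda>z. f z / g z)"
  define H where "H = remove_sings h"
  have merh: "h meromorphic_on UNIV" unfolding h_def by (intro meromorphic_intros mer)
  hence merH: "H meromorphic_on UNIV" unfolding H_def by (intro meromorphic_intros)
  have g0: "\<forall>\<^sub>\<approx>z. g z \<noteq> 0" using meromorphic_imp_constant_or_avoid[OF mer(2), of 0] g by auto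
  have dH: "\<forall>\<^sub>\<approx>z. deriv H z = 0"
    using g0 w meromorphic_on_imp_analytic_cosparse[OF mer(1)] meromorphic_on_imp_analytic_cosparse[OF mer(2)]
  proof eventually_elim
    case (elim z)
    have "h analytic_on {z}" unfolding h_def using elim by (intro analytic_intros) auto
    hence "deriv H z = deriv h z" unfolding H_def by (rule deriv_remove_sings_at_analytic)
    also have "(h has_field_derivative (deriv f z * g z - f z * deriv g z) / (g z * g z)) (at z)"
      unfolding h_def using elim by (intro DERIV_divide analytic_derivI)
    hence "deriv h z = (deriv f z * g z - f z * deriv g z) / (g z * g z)" by (rule DERIV_imp_deriv)
    also have "\<dots> = 0" using elim by simp
    finally show ?case .
  qed
  have "\<exists>z. H analytic_on {z}"
    using eventually_happens[OF meromorphic_on_imp_analytic_cosparse[OF merH]] by auto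
  then obtain z r where r: "r > 0" "H holomorphic_on ball z r" by (auto simp: analytic_on_def)
  have zero: "deriv H x = 0" if "x \<in> ball z r" for x
  proof -
    have "isCont (deriv H) x"
      using r that by (meson at_within_open centre_in_ball continuous_on_eq_continuous_at holomorphic_deriv holomorphic_on_imp_continuous_on open_ball)
    hence "(deriv H \<longlongrightarrow> deriv H x) (at x)" by (rule isContD)
    moreover have "(deriv H \<longlongrightarrow> 0) (at x)"
      using dH eventually_cosparse_imp_eventually_at by (intro tendsto_eventually) blast
    ultimately show ?thesis using LIM_unique by blast
  qed
  have "\<exists>c. \<forall>x\<in>ball z r. H x = c"
  proof (rule has_field_derivative_zero_constant)
    fix x assume x: "x \<in> ball z r"
    have "(H has_field_derivative deriv H x) (at x)" using x r holomorphic_derivI by blast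
    thus "(H has_field_derivative 0) (at x within ball z r)"
      using zero[OF x] has_field_derivative_at_within by metis
  qed auto
  then obtain c where c: "\<And>x. x \<in> ball z r \<Longrightarrow> H x = c" by blast
  have "\<not> (\<forall>\<^sub>\<approx>x. H x \<noteq> c)"
  proof
    assume "\<forall>\<^sub>\<approx>x. H x \<noteq> c"
    hence "\<forall>\<^sub>F x in at z. H x \<noteq> c" using eventually_cosparse_imp_eventually_at by blast
    moreover have "\<forall>\<^sub>F x in at z. x \<in> ball z r" using r eventually_at_in_open'[of "ball z r" z] by auto
    ultimately have "\<forall>\<^sub>F x in at z. False" by eventually_elim (use c in auto)
    thus False by simp
  qed
  hence "\<forall>\<^sub>\<approx>x. H x = c" using meromorphic_imp_constant_or_avoid[OF merH, of c] by auto
  with eventually_remove_sings_eq[OF merh] g0 have "\<forall>\<^sub>\<approx>z. f z = c * g z"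
    by eventually_elim (metis H_def h_def nonzero_divide_eq_eq)
  thus ?thesis by blast
qed

text \<open>A nonzero \<open>Q\<close> has finitely many roots, and a non-constant g avoids each of
  them outside a sparse set.\<close>

lemma nonconst_meromorphic_transcendental:
  assumes g: "nonconst_meromorphic g" and Q: "\<forall>\<^sub>\<approx>z. poly Q (g z) = 0"
  shows "Q = 0"
proof (rule ccontr)
  assume "Q \<noteq> 0"
  hence fin: "finite {x. poly Q x = 0}" by (rule poly_roots_finite)
  have "\<forall>\<^sub>\<approx>z. g z \<noteq> r" for r
    using meromorphic_imp_constant_or_avoid[of g UNIV r] g by (auto simp: nonconst_meromorphic_def)
  hence "\<forall>\<^sub>\<approx>z. \<forall>r\<in>{x. poly Q x = 0}. g z \<noteq> r" using fin by (intro eventually_ball_finite) auto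
  with Q have "\<forall>\<^sub>\<approx>(z::complex). False" by eventually_elim auto
  thus False by simp
qed

text \<open>Once f = d g, the polynomial P(d X) - c P(X) vanishes at the non-constant g, hence
  identically. The coefficient identity is what the later gcd argument needs.\<close>

lemma meromorphic_multiple:
  fixes P :: "complex poly" and f g :: "complex \<Rightarrow> complex"
  assumes gap: "\<And>i. m < i \<Longrightarrow> i < degree P \<Longrightarrow> coeff P i = 0" and n: "m + 4 \<le> degree P" and c: "c \<noteq> 0"
    and f: "f meromorphic_on UNIV" and g: "nonconst_meromorphic g"
    and eq: "\<forall>\<^sub>\<approx>z. poly P (f z) = c * poly P (g z)"
  shows "\<exists>d. (\<forall>\<^sub>\<approx>z. f z = d * g z) \<and> pcompose P [:0, d:] = smult c P"
proof -
  have g': "g meromorphic_on UNIV" using g by (simp add: nonconst_meromorphic_def)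
  note ev = eventually_remove_sings_eq[OF f] eventually_remove_sings_eq[OF g']
  have "\<forall>\<^sub>\<approx>z. poly P (remove_sings f z) = c * poly P (remove_sings g z)"
    using ev eq by eventually_elim simp
  hence "\<forall>\<^sub>\<approx>z. remove_sings f z * deriv (remove_sings g) z - deriv (remove_sings f) z * remove_sings g z = 0"
    by (intro meromorphic_wronskian_eq_0[OF gap n c] remove_sings_nicely_meromorphic f g')
  moreover have "\<not> (\<forall>\<^sub>\<approx>z. remove_sings g z = 0)"
  proof
    assume "\<forall>\<^sub>\<approx>z. remove_sings g z = 0"
    with ev(2) have "\<forall>\<^sub>\<approx>z. g z = 0" by eventually_elim simp
    thus False using g by (auto simp: nonconst_meromorphic_def)
  qed
  ultimately obtain d where d: "\<forall>\<^sub>\<approx>z. remove_sings f z = d * remove_sings g z"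
    using meromorphic_proportional_of_wronskian_eq_0 f g' remove_sings_meromorphic by blast
  have d': "\<forall>\<^sub>\<approx>z. f z = d * g z" using d ev by eventually_elim simp
  have "\<forall>\<^sub>\<approx>z. poly (pcompose P [:0, d:] - smult c P) (g z) = 0"
    using d' eq by eventually_elim (simp add: poly_pcompose mult.commute)
  hence "pcompose P [:0, d:] - smult c P = 0" by (rule nonconst_meromorphic_transcendental[OF g])
  thus ?thesis using d' by auto
qed

subsection \<open>Rational solutions\<close>

text \<open>The zero polynomial has degree 0 by convention, so vanishing must be a separate
  alternative to a strict drop in degree. Statements of this shape are stable under
  differences.\<close>

lemma mult_pderiv_eq_0_or_degree_less:
  fixes a b :: "complex poly"
  shows "a * pderiv b = 0 \<or> degree (a * pderiv b) < degree a + degree b"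
proof (cases "a * pderiv b = 0")
  case False
  hence "a \<noteq> 0" "pderiv b \<noteq> 0" "degree b > 0" by (auto simp: pderiv_eq_0_iff)
  thus ?thesis by (simp add: degree_mult_eq degree_pderiv)
qed simp

lemma diff_eq_0_or_degree_less:
  fixes a b :: "complex poly"
  shows "a = 0 \<or> degree a < N \<Longrightarrow> b = 0 \<or> degree b < N \<Longrightarrow> a - b = 0 \<or> degree (a - b) < N"
  by (auto intro: degree_diff_less)

text \<open>Comparing leading coefficients, every nonzero solution \<open>p\<close> of the linear
  equation has the degree of \<open>r\<close>. Subtracting the multiple of \<open>r\<close> that
  kills the leading coefficient gives a solution violating this, unless it is 0.\<close>

lemma proportional_of_wronskian_eq_0:
  fixes p r :: "complex poly"
  assumes "r \<noteq> 0" and W: "pderiv p * r = p * pderiv r"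
  shows "\<exists>c. p = smult c r"
proof -
  have deg: "degree p = degree r" if "p \<noteq> 0" "pderiv p * r = p * pderiv r" for p
  proof (cases "degree p = 0 \<or> degree r = 0")
    case True
    moreover have "degree p = 0 \<longleftrightarrow> degree r = 0" using that assms(1) by (metis mult_eq_0_iff pderiv_eq_0_iff)
    ultimately show ?thesis by auto
  next
    case False
    have lc: "lead_coeff (pderiv s) = of_nat (degree s) * lead_coeff s" if "degree s \<noteq> 0" for s :: "complex poly"
      using that by (simp add: coeff_pderiv degree_pderiv)
    have "lead_coeff (pderiv p * r) = lead_coeff (p * pderiv r)" using that by simp
    hence "of_nat (degree p) * (lead_coeff p * lead_coeff r) = (of_nat (degree r) * (lead_coeff p * lead_coeff r) :: complex)"
      unfolding lead_coeff_mult using lc[of p] lc[of r] False by (simp add: mult_ac)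
    thus ?thesis using that(1) assms(1) by simp
  qed
  define c where "c = (if p = 0 then 0 else lead_coeff p / lead_coeff r)"
  define s where "s = p - smult c r"
  have "s = 0"
  proof (rule ccontr)
    assume "s \<noteq> 0"
    hence p: "p \<noteq> 0" by (auto simp: s_def c_def)
    have "pderiv s * r = s * pderiv r" using W by (simp add: s_def pderiv_diff pderiv_smult algebra_simps)
    hence "degree s = degree r" using deg \<open>s \<noteq> 0\<close> by blast
    moreover have "coeff s (degree r) = 0"
      using deg[OF p W] assms(1) p by (simp add: s_def c_def)
    ultimately show False using \<open>s \<noteq> 0\<close> by (metis leading_coeff_0_iff)
  qed
  thus ?thesis by (auto simp: s_def)
qed

text \<open>Differentiating \<open>D = p\<^sup>n - c r\<^sup>n\<close> shows that the Wronskian of \<open>p\<close> and \<open>r\<close> is divisible by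
  \<open>q\<^sup>k\<^sup>-\<^sup>1\<close>, hence by \<open>q\<^sup>2\<close>; comparing degrees leaves only the zero polynomial.\<close>

lemma wronskian_poly_eq_0:
  fixes p q r Y :: "complex poly"
  assumes D: "p ^ (m + k) - smult c (r ^ (m + k)) = q ^ k * Y"
    and c: "c \<noteq> 0" and k: "k \<ge> 3" and cop: "coprime p q" and q: "q \<noteq> 0"
    and Y: "\<And>e. degree p \<le> e \<Longrightarrow> degree q \<le> e \<Longrightarrow> degree r \<le> e \<Longrightarrow> degree Y \<le> m * e"
  shows "pderiv p * r = p * pderiv r"
proof (rule ccontr)
  define W where "W = pderiv p * r - p * pderiv r"
  assume "pderiv p * r \<noteq> p * pderiv r"
  hence W0: "W \<noteq> 0" by (simp add: W_def)
  hence p0: "p \<noteq> 0" by (auto simp: W_def)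
  obtain k' where k': "k = Suc k'" "k' \<ge> 2" using k by (cases k) auto
  define n' where "n' = m + k'"
  have n': "m + k = Suc n'" by (simp add: n'_def k')
  \<comment> \<open>In r D' - n r' D the powers of r cancel, leaving n p^(n-1) W. Computed instead
    from D = q^k Y, the same expression is q^(k-1) Z.\<close>
  define Z where "Z = r * q * pderiv Y - pderiv r * (smult (of_nat (Suc n')) (q * Y)) + smult (of_nat k) (r * Y * pderiv q)"
  define D where "D = p ^ Suc n' - smult c (r ^ Suc n')"
  have "D = q ^ k * Y" using assms(1) unfolding D_def n' .
  hence DY: "D = q ^ Suc k' * Y" by (simp only: k')
  have "r * pderiv D - smult (of_nat (Suc n')) (pderiv r * D) = smult (of_nat (Suc n')) (p ^ n' * W)"
    unfolding D_def W_def pderiv_diff pderiv_smult pderiv_power_Suc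
    by (simp add: algebra_simps smult_diff_right smult_add_right del: of_nat_Suc)
  moreover have "r * pderiv D - smult (of_nat (Suc n')) (pderiv r * D) = q ^ k' * Z"
  proof -
    have sm: "smult a x = [:a:] * x" for a and x :: "complex poly" by simp
    show ?thesis unfolding DY Z_def k'(1) pderiv_mult pderiv_power_Suc
      unfolding sm power_Suc by algebra
  qed
  ultimately have eq: "smult (of_nat (Suc n')) (p ^ n' * W) = q ^ k' * Z" by simp
  hence "q ^ k' dvd smult (of_nat (Suc n')) (p ^ n' * W)" by simp
  hence "q ^ k' dvd p ^ n' * W" by (subst (asm) dvd_smult_iff) (auto simp del: of_nat_Suc)
  moreover have "coprime (q ^ k') (p ^ n')" using cop by (simp add: coprime_commute)
  ultimately have "q ^ k' dvd W" by (simp add: coprime_dvd_mult_right_iff)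
  hence "degree (q ^ k') \<le> degree W" using W0 by (rule dvd_imp_degree_le)
  hence dW: "k' * degree q \<le> degree W" using q by (simp add: degree_power_eq)
  have W_less: "degree W < degree p + degree r"
    using diff_eq_0_or_degree_less[of "r * pderiv p" "degree p + degree r" "p * pderiv r"]
      mult_pderiv_eq_0_or_degree_less[of r p] mult_pderiv_eq_0_or_degree_less[of p r] W0
    by (simp add: W_def mult.commute add.commute)
  define e where "e = max (degree p) (degree r)"
  \<comment> \<open>If e <= deg q, neither p/q nor r/q has a pole at infinity, and q^2 dividing W
    already contradicts deg W < deg p + deg r. Otherwise there is a pole at infinity, and degrees in
    n p^(n-1) W = q^(k-1) Z are compared.\<close>
  show False
  proof (cases "e \<le> degree q")
    case True
    have "2 * degree q \<le> k' * degree q" using k' by simp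
    moreover have "degree p \<le> degree q" "degree r \<le> degree q" using True by (auto simp: e_def)
    ultimately show False using dW W_less by linarith
  next
    case False
    have degY: "degree Y \<le> m * e" using False by (intro Y) (auto simp: e_def)
    have Z0: "Z \<noteq> 0" using eq W0 p0 by (auto simp del: of_nat_Suc)
    have Y0: "Y \<noteq> 0" using Z0 by (auto simp: Z_def)
    \<comment> \<open>Otherwise r^n alone determines the degree of D, namely n e, whereas q^k Y has
      degree at most k deg q + m e, which is smaller.\<close>
    have "degree p = e"
    proof (rule ccontr)
      assume "degree p \<noteq> e"
      hence less: "degree p < e" "degree r = e" by (auto simp: e_def)
      hence "r \<noteq> 0" by auto
      have "degree (p ^ (m + k)) < degree (- smult c (r ^ (m + k)))"
        using less p0 \<open>r \<noteq> 0\<close> c k by (simp add: degree_power_eq)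
      hence "degree (p ^ (m + k) + - smult c (r ^ (m + k))) = degree (- smult c (r ^ (m + k)))"
        by (rule degree_add_eq_right)
      hence "degree (q ^ k * Y) = (m + k) * e"
        unfolding assms(1)[symmetric] using less \<open>r \<noteq> 0\<close> c by (simp add: degree_power_eq)
      hence "k * degree q + degree Y = (m + k) * e" using q Y0 by (simp add: degree_mult_eq degree_power_eq)
      hence "k * e \<le> k * degree q" using degY unfolding distrib_right by linarith
      thus False using k False by simp
    qed
    let ?N = "degree r + degree q + degree Y"
    have 1: "r * q * pderiv Y = 0 \<or> degree (r * q * pderiv Y) < ?N"
      using mult_pderiv_eq_0_or_degree_less[of "r * q" Y] degree_mult_le[of r q] by linarith
    have 2: "pderiv r * smult (of_nat (Suc n')) (q * Y) = 0 \<or> degree (pderiv r * smult (of_nat (Suc n')) (q * Y)) < ?N"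
      using mult_pderiv_eq_0_or_degree_less[of "smult (of_nat (Suc n')) (q * Y)" r] degree_mult_le[of q Y]
        degree_smult_le[of "of_nat (Suc n')" "q * Y"] unfolding mult.commute[of "pderiv r"] by linarith
    have 3: "- smult (of_nat k) (r * Y * pderiv q) = 0 \<or> degree (- smult (of_nat k) (r * Y * pderiv q)) < ?N"
      using mult_pderiv_eq_0_or_degree_less[of "r * Y" q] degree_mult_le[of r Y] k by auto
    have "Z = 0 \<or> degree Z < ?N"
      using diff_eq_0_or_degree_less[OF diff_eq_0_or_degree_less[OF 1 2] 3] by (simp add: Z_def)
    hence degZ: "degree Z < e + degree q + m * e" using Z0 degY by (simp add: e_def)
    have "degree (smult (of_nat (Suc n')) (p ^ n' * W)) = n' * e + degree W"
      using p0 W0 \<open>degree p = e\<close> by (simp add: degree_mult_eq degree_power_eq del: of_nat_Suc)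
    moreover have "degree (q ^ k' * Z) = k' * degree q + degree Z"
      using q Z0 by (simp add: degree_mult_eq degree_power_eq)
    ultimately have "n' * e + degree W = k' * degree q + degree Z" using eq by metis
    \<comment> \<open>As deg W >= k' deg q, those terms drop out, leaving k' e < e + deg q < 2 e,
      against k' >= 2.\<close>
    hence "n' * e < e + degree q + m * e" using dW degZ by linarith
    moreover have "2 * e \<le> k' * e" using k' by simp
    moreover have "n' * e = m * e + k' * e" by (simp add: n'_def distrib_right)
    ultimately show False using False by linarith
  qed
qed

section \<open>Evaluation of polynomials at rational functions, and homogenisation\<close>

lemma rat_const_0 [simp]: "rat_const 0 = 0" by (simp add: rat_const_def)
lemma rat_const_1 [simp]: "rat_const 1 = 1" by (simp add: rat_const_def one_pCons[symmetric])
lemma rat_const_add [simp]: "rat_const (a + b) = rat_const a + rat_const b"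
  by (simp add: rat_const_def flip: to_fract_add)
lemma rat_const_mult [simp]: "rat_const (a * b) = rat_const a * rat_const b"
  by (simp add: rat_const_def flip: to_fract_mult)
lemma rat_const_uminus [simp]: "rat_const (- a) = - rat_const a"
  by (simp add: rat_const_def flip: to_fract_uminus)
lemma rat_const_eq_iff [simp]: "rat_const a = rat_const b \<longleftrightarrow> a = b"
  by (simp add: rat_const_def)
lemma rat_const_eq_0_iff [simp]: "rat_const a = 0 \<longleftrightarrow> a = 0"
  by (simp add: rat_const_def)

abbreviation rat_eval :: "complex poly \<Rightarrow> complex poly fract \<Rightarrow> complex poly fract" where
  "rat_eval P \<equiv> poly (map_poly rat_const P)"

lemma rat_eval_pCons [simp]: "rat_eval (pCons a P) x = rat_const a + x * rat_eval P x"
  by (simp add: map_poly_pCons)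

lemma rat_eval_add [simp]: "rat_eval (P + Q) x = rat_eval P x + rat_eval Q x"
proof (induction P arbitrary: Q)
  case (pCons a P)
  show ?case by (cases Q) (simp only: add_pCons rat_eval_pCons rat_const_add pCons.IH, simp add: algebra_simps)
qed simp

lemma rat_eval_smult [simp]: "rat_eval (smult c P) x = rat_const c * rat_eval P x"
  by (induction P) (simp_all add: algebra_simps)

lemma rat_eval_mult [simp]: "rat_eval (P * Q) x = rat_eval P x * rat_eval Q x"
  by (induction P) (simp_all add: algebra_simps)

lemma rat_eval_diff [simp]: "rat_eval (P - Q) x = rat_eval P x - rat_eval Q x"
  using rat_eval_add[of "P - Q" Q x] by (simp add: algebra_simps del: rat_eval_add)

lemma rat_eval_pcompose [simp]: "rat_eval (pcompose P Q) x = rat_eval P (rat_eval Q x)"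
  by (induction P) (simp_all add: pcompose_pCons)

text \<open>The complex numbers are algebraically closed: \<open>Q\<close> splits into linear
  factors, and g - z is nonzero in the field for every constant z.\<close>

lemma rat_eval_eq_0_imp_eq_0:
  assumes "g \<notin> range rat_const" "rat_eval Q g = 0"
  shows "Q = 0"
  using assms(2)
proof (induction "degree Q" arbitrary: Q)
  case 0
  then obtain a where "Q = [:a:]" by (metis degree_eq_zeroE)
  thus ?case using 0 by simp
next
  case (Suc d)
  have "\<exists>z. poly Q z = 0"
    using Suc.hyps(2) by (intro fundamental_theorem_of_algebra) (auto simp: constant_degree)
  then obtain z R where R: "Q = [:- z, 1:] * R" by (metis poly_eq_0_iff_dvd dvdE)
  have "R \<noteq> 0" using R Suc.hyps(2) by auto
  hence "degree Q = Suc (degree R)" unfolding R by (subst degree_mult_eq) auto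
  moreover have "(g - rat_const z) * rat_eval R g = 0" using Suc.prems unfolding R rat_eval_mult by simp
  moreover have "g \<noteq> rat_const z" using assms(1) by blast
  ultimately show ?case using Suc.hyps R \<open>R \<noteq> 0\<close> by simp
qed

text \<open>This is q^n P(p/q) for n = deg P, the binary form of \<open>P\<close>; it turns P(f) = c
  P(g) into an identity between polynomials.\<close>

definition homogenize :: "complex poly \<Rightarrow> complex poly \<Rightarrow> complex poly \<Rightarrow> complex poly" where
  "homogenize P p q = (\<Sum>i\<le>degree P. smult (coeff P i) (p ^ i * q ^ (degree P - i)))"

lemma rat_eval_homogenize:
  assumes "q \<noteq> 0"
  shows "rat_eval P (to_fract p / to_fract q) * to_fract (q ^ degree P) = to_fract (homogenize P p q)"
proof -
  have tp: "to_fract (x ^ i) = to_fract x ^ i" for x :: "complex poly" and i by (induction i) simp_all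
  have sm: "to_fract (smult a x) = rat_const a * to_fract x" for a x
    by (simp add: rat_const_def flip: to_fract_mult)
  have "rat_eval P (to_fract p / to_fract q) * to_fract (q ^ degree P)
     = (\<Sum>i\<le>degree P. rat_const (coeff P i) * (to_fract p / to_fract q) ^ i * to_fract q ^ degree P)"
    by (simp add: poly_altdef degree_map_poly coeff_map_poly sum_distrib_right tp)
  also have "\<dots> = (\<Sum>i\<le>degree P. rat_const (coeff P i) * (to_fract p ^ i * to_fract q ^ (degree P - i)))"
    using assms by (intro sum.cong) (auto simp: power_divide power_diff)
  also have "\<dots> = to_fract (homogenize P p q)" by (simp add: homogenize_def sm tp)
  finally show ?thesis .
qed

text \<open>Below the top term only exponents i <= m occur, so each q^(n-i) contains q^k: the gap in
  \<open>P\<close> becomes divisibility by a power of the denominator.\<close>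

lemma homogenize_gap:
  assumes gap: "\<And>i. m < i \<Longrightarrow> i < degree P \<Longrightarrow> coeff P i = 0" and n: "degree P = m + k" "k > 0"
  shows "homogenize P p q = smult (lead_coeff P) (p ^ (m + k)) + q ^ k * (\<Sum>i\<le>m. smult (coeff P i) (p ^ i * q ^ (m - i)))"
proof -
  have "homogenize P p q = (\<Sum>i\<in>insert (m + k) {..m}. smult (coeff P i) (p ^ i * q ^ (degree P - i)))"
    unfolding homogenize_def using gap n by (intro sum.mono_neutral_right) auto
  also have "\<dots> = smult (lead_coeff P) (p ^ (m + k)) + (\<Sum>i\<le>m. smult (coeff P i) (p ^ i * q ^ (m + k - i)))"
    using n by (subst sum.insert) auto
  also have "(\<Sum>i\<le>m. smult (coeff P i) (p ^ i * q ^ (m + k - i))) = q ^ k * (\<Sum>i\<le>m. smult (coeff P i) (p ^ i * q ^ (m - i)))"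
    unfolding sum_distrib_left
  proof (intro sum.cong refl)
    fix i assume "i \<in> {..m}"
    hence "m + k - i = k + (m - i)" by simp
    thus "smult (coeff P i) (p ^ i * q ^ (m + k - i)) = q ^ k * smult (coeff P i) (p ^ i * q ^ (m - i))"
      by (simp add: power_add mult_ac)
  qed
  finally show ?thesis .
qed

text \<open>A pole of \<open>g\<close> is a pole of \<open>f\<close> of the same order, so the reduced denominator of \<open>g\<close> divides that of \<open>f\<close>.\<close>

lemma rational_multiple:
  assumes gap: "\<And>i. m < i \<Longrightarrow> i < degree P \<Longrightarrow> coeff P i = 0" and n: "m + 3 \<le> degree P" and c: "c \<noteq> 0"
    and g: "g \<notin> range rat_const"
    and eq: "rat_eval P f = rat_const c * rat_eval P g"
  shows "\<exists>d. f = rat_const d * g \<and> pcompose P [:0, d:] = smult c P"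
proof -
  define k where "k = degree P - m"
  have k: "degree P = m + k" "k \<ge> 3" using n by (auto simp: k_def)
  let ?n = "degree P"
  have "P \<noteq> 0" using k by auto
  hence lc: "lead_coeff P \<noteq> 0" by simp
  obtain p q where pq: "f = to_fract p / to_fract q" "q \<noteq> 0" "coprime p q"
    using coprime_quot_of_fract[of f] Fract_quot_of_fract[of f] by (metis Fract_conv_to_fract snd_quot_of_fract_nonzero)
  obtain s t where st: "g = to_fract s / to_fract t" "t \<noteq> 0" "coprime s t"
    using coprime_quot_of_fract[of g] Fract_quot_of_fract[of g] by (metis Fract_conv_to_fract snd_quot_of_fract_nonzero)
  have "to_fract (homogenize P p q * t ^ ?n) = to_fract (smult c (homogenize P s t * q ^ ?n))"
  proof -
    have "to_fract (homogenize P p q * t ^ ?n) = rat_eval P f * to_fract (q ^ ?n) * to_fract (t ^ ?n)"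
      using rat_eval_homogenize[OF pq(2), of P p] pq(1) by simp
    also have "\<dots> = rat_const c * (rat_eval P g * to_fract (t ^ ?n)) * to_fract (q ^ ?n)" by (simp add: eq mult_ac)
    also have "\<dots> = rat_const c * to_fract (homogenize P s t) * to_fract (q ^ ?n)"
      using rat_eval_homogenize[OF st(2), of P s] st(1) by simp
    also have "\<dots> = to_fract (smult c (homogenize P s t * q ^ ?n))"
      by (simp add: rat_const_def flip: to_fract_mult)
    finally show ?thesis .
  qed
  hence "homogenize P p q * t ^ ?n = smult c (homogenize P s t * q ^ ?n)" by (simp only: to_fract_eq_iff)
  hence "t ^ ?n dvd smult c (homogenize P s t * q ^ ?n)" by (metis dvd_triv_right)
  hence "t ^ ?n dvd homogenize P s t * q ^ ?n" using c by (simp add: dvd_smult_iff)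
  \<comment> \<open>Modulo \<open>t\<close>, only the top term of the binary form survives, a
    nonzero multiple of s^n, which is coprime to \<open>t\<close>.\<close>
  moreover have "coprime (t ^ ?n) (homogenize P s t)"
  proof -
    obtain R where R: "homogenize P s t = smult (lead_coeff P) (s ^ (m + k)) + t * R"
      using homogenize_gap[OF gap k(1), where p = s and q = t] k(2) by (cases k) (auto simp: mult.assoc)
    have "coprime t (smult (lead_coeff P) (s ^ (m + k)))"
    proof -
      have "coprime t [:lead_coeff P:]" using lc by (intro is_unit_right_imp_coprime) (simp add: is_unit_const_poly_iff dvd_field_iff)
      moreover have "coprime t (s ^ (m + k))" using st(3) by (simp add: coprime_commute)
      ultimately have "coprime t ([:lead_coeff P:] * s ^ (m + k))" by (simp only: coprime_mult_right_iff)
      moreover have "[:lead_coeff P:] * s ^ (m + k) = smult (lead_coeff P) (s ^ (m + k))" by simp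
      ultimately show ?thesis by (simp only:)
    qed
    hence "coprime t (homogenize P s t)" unfolding R by (metis add.commute coprime_iff_gcd_eq_1 gcd_add_mult mult.commute)
    thus ?thesis by simp
  qed
  ultimately have "t ^ ?n dvd q ^ ?n" by (simp add: coprime_dvd_mult_right_iff)
  hence "t dvd q" using k by (subst (asm) pow_divides_pow_iff) auto
  then obtain u where u: "q = t * u" by auto
  \<comment> \<open>This writes g over the denominator \<open>q\<close> of f. The fraction r/q may
    fail to be reduced; p/q is reduced.\<close>
  define r where "r = s * u"
  have u0: "u \<noteq> 0" using u pq by auto
  have gr: "g = to_fract r / to_fract q" using st u u0 by (simp add: r_def)
  have "to_fract (homogenize P p q) = to_fract (smult c (homogenize P r q))"
  proof -
    have "to_fract (homogenize P p q) = rat_eval P f * to_fract (q ^ ?n)"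
      using rat_eval_homogenize[OF pq(2), of P p] pq(1) by simp
    also have "\<dots> = rat_const c * (rat_eval P g * to_fract (q ^ ?n))" by (simp add: eq mult_ac)
    also have "\<dots> = rat_const c * to_fract (homogenize P r q)"
      using rat_eval_homogenize[OF pq(2), of P r] gr by simp
    also have "\<dots> = to_fract (smult c (homogenize P r q))"
      by (simp add: rat_const_def flip: to_fract_mult)
    finally show ?thesis .
  qed
  hence hom: "homogenize P p q = smult c (homogenize P r q)" by (simp only: to_fract_eq_iff)
  define T where "T = (\<lambda>x. \<Sum>i\<le>m. smult (coeff P i) (x ^ i * q ^ (m - i)))"
  \<comment> \<open>Solving the homogenised equation for p^n - c r^n leaves q^k times this
    polynomial.\<close>
  define Y where "Y = smult (inverse (lead_coeff P)) (smult c (T r) - T p)"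
  have degT: "degree (T x) \<le> m * e" if "degree x \<le> e" "degree q \<le> e" for x e
    unfolding T_def
  proof (rule degree_sum_le)
    fix i assume i: "i \<in> {..m}"
    have "degree (smult (coeff P i) (x ^ i * q ^ (m - i))) \<le> degree (x ^ i) + degree (q ^ (m - i))"
      using degree_smult_le degree_mult_le order_trans by blast
    also have "\<dots> \<le> e * i + e * (m - i)"
      using that degree_power_le by (intro add_mono order_trans[OF degree_power_le] mult_right_mono) auto
    also have "\<dots> = m * e" using i by (simp flip: distrib_left)
    finally show "degree (smult (coeff P i) (x ^ i * q ^ (m - i))) \<le> m * e" .
  qed simp
  have hg: "homogenize P x q = smult (lead_coeff P) (x ^ (m + k)) + q ^ k * T x" for x
    unfolding T_def using k(2) by (intro homogenize_gap gap k(1)) auto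
  have "pderiv p * r = p * pderiv r"
  proof (rule wronskian_poly_eq_0[where Y = Y])
    have "smult (lead_coeff P) (p ^ (m + k)) + q ^ k * T p = smult c (smult (lead_coeff P) (r ^ (m + k)) + q ^ k * T r)"
      using hom unfolding hg .
    hence "smult (lead_coeff P) (p ^ (m + k) - smult c (r ^ (m + k))) = q ^ k * (smult c (T r) - T p)"
      by (simp add: algebra_simps smult_diff_right smult_add_right)
    hence "smult (inverse (lead_coeff P)) (smult (lead_coeff P) (p ^ (m + k) - smult c (r ^ (m + k)))) = q ^ k * Y"
      by (simp add: Y_def)
    thus "p ^ (m + k) - smult c (r ^ (m + k)) = q ^ k * Y" using lc by simp
  next
    fix e assume "degree p \<le> e" "degree q \<le> e" "degree r \<le> e"
    thus "degree Y \<le> m * e" unfolding Y_def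
      by (intro order_trans[OF degree_smult_le] degree_diff_le degT)
  qed (use c k pq in auto)
  moreover have "r \<noteq> 0" using g gr by (metis div_0 rangeI rat_const_0 to_fract_0)
  ultimately obtain d where d: "p = smult d r" using proportional_of_wronskian_eq_0 by blast
  have fd: "f = rat_const d * g" unfolding pq(1) gr d by (simp add: rat_const_def flip: to_fract_mult)
  have "rat_eval (pcompose P [:0, d:] - smult c P) g = 0"
    using eq by (simp add: fd mult.commute)
  hence "pcompose P [:0, d:] - smult c P = 0" by (rule rat_eval_eq_0_imp_eq_0[OF g])
  thus ?thesis using fd by auto
qed

subsection \<open>Greatest common divisors and roots of unity\<close>

text \<open>The positive element of \<open>J\<close> gives d a finite order; division with remainder
  shows that this order divides all of \<open>J\<close>, hence its gcd.\<close>

lemma power_eq_1_of_Gcd_eq_1: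
  fixes d :: complex
  assumes J: "\<And>j. j \<in> J \<Longrightarrow> d ^ j = 1" and j: "j \<in> J" "j > 0" and "Gcd J = (1::nat)"
  shows "d = 1"
proof -
  define o' where "o' = (LEAST k. k > 0 \<and> d ^ k = 1)"
  have o': "o' > 0" "d ^ o' = 1" "\<And>k. k > 0 \<Longrightarrow> d ^ k = 1 \<Longrightarrow> o' \<le> k"
    using LeastI[of "\<lambda>k. k > 0 \<and> d ^ k = 1" j] Least_le[of "\<lambda>k. k > 0 \<and> d ^ k = 1"] J[OF j(1)] j(2)
    by (auto simp: o'_def)
  have "o' dvd i" if "i \<in> J" for i
  proof (rule ccontr)
    assume "\<not> o' dvd i"
    hence "i mod o' > 0" by (simp add: dvd_eq_mod_eq_0)
    moreover have "d ^ (i mod o') = 1"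
    proof -
      have "1 = d ^ (o' * (i div o') + i mod o')" using J[OF that] by simp
      thus ?thesis unfolding power_add power_mult o'(2) by simp
    qed
    ultimately show False using o'(3)[of "i mod o'"] o'(1) by (metis mod_less_divisor not_le)
  qed
  hence "o' dvd Gcd J" by (rule Gcd_greatest)
  thus "d = 1" using o'(2) assms(4) by simp
qed

section \<open>Scaling symmetries P(d X) = c P(X) and the two equivalences\<close>

theorem theorem1:
  fixes P :: "complex poly" and a :: "nat \<Rightarrow> complex" and n m l :: nat and I J :: "nat set"
  assumes "m < n"
    and "a n \<noteq> 0" and "a m \<noteq> 0"
    and "P = monom (a n) n + (\<Sum>i=0..m. monom (a i) i)"
    and "I = {i. coeff P i \<noteq> 0}"
    and "l = Min I"
    and "J = {i - l | i. i \<in> I}"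
  shows "(n - m \<ge> 3 \<longrightarrow> (strong_uniqueness_poly_rational P \<longleftrightarrow> Gcd I = 1 \<and> Gcd J = 1)) \<and>
         (n - m \<ge> 4 \<longrightarrow> (strong_uniqueness_poly_meromorphic P \<longleftrightarrow> Gcd I = 1 \<and> Gcd J = 1))"
proof -
  have coeff: "coeff P i = (if i = n then a n else if i \<le> m then a i else 0)" for i
    using \<open>m < n\<close> unfolding assms(4) by (auto simp: coeff_sum)
  have degP: "degree P = n"
    using \<open>a n \<noteq> 0\<close> \<open>m < n\<close> by (intro antisym degree_le le_degree) (auto simp: coeff)
  have gap: "coeff P i = 0" if "m < i" "i < degree P" for i
    using that by (simp add: coeff degP)
  have mn: "m \<in> I" "n \<in> I" using assms(1,2,3) by (auto simp: assms(5) coeff)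
  have fin: "finite I" by (rule finite_subset[of _ "{..n}"]) (auto simp: assms(5) degP intro: le_degree[of P, unfolded degP])
  have l: "l \<in> I" "\<And>i. i \<in> I \<Longrightarrow> l \<le> i"
    using fin mn unfolding assms(6) by (auto intro: Min_in)
  have nJ: "n - l \<in> J" "n - l > 0" using mn assms(1) l(2)[OF mn(1)] by (auto simp: assms(7))
  have GcdI: "Gcd I = 1" if "Gcd J = 1"
  proof -
    have "Gcd I dvd j" if "j \<in> J" for j
      using that l(1) unfolding assms(7) by (blast intro: dvd_diff_nat Gcd_dvd)
    hence "Gcd I dvd Gcd J" by (rule Gcd_greatest)
    thus ?thesis using that by simp
  qed
  have unique: "c = 1 \<and> d = 1" if "Gcd J = 1" "pcompose P [:0, d:] = smult c P" "c \<noteq> 0" for c d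
  proof -
    have dc: "d ^ i = c" if "i \<in> I" for i
    proof -
      have "d ^ i * coeff P i = c * coeff P i"
        using arg_cong[OF \<open>pcompose P [:0, d:] = smult c P\<close>, of "\<lambda>Q. coeff Q i"] by (simp add: coeff_pcompose_linear)
      thus ?thesis using that by (simp add: assms(5))
    qed
    have "d ^ j = 1" if "j \<in> J" for j
    proof -
      obtain i where i: "i \<in> I" "j = i - l" using \<open>j \<in> J\<close> unfolding assms(7) by blast
      have "d ^ i = d ^ l * d ^ j" using l(2)[OF i(1)] i(2) by (simp flip: power_add)
      thus ?thesis using dc[OF l(1)] dc[OF i(1)] \<open>c \<noteq> 0\<close> by simp
    qed
    hence "d = 1" using nJ \<open>Gcd J = 1\<close> by (rule power_eq_1_of_Gcd_eq_1)
    thus ?thesis using dc[OF l(1)] by simp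
  qed
  \<comment> \<open>A symmetry with d different from 1 refutes strong uniqueness, through the pair d
    X and X, whatever the value of c. If \<open>Gcd J = 1\<close>, the trivial symmetry fills
    in.\<close>
  obtain d c :: complex where counter: "d \<noteq> 0" "c \<noteq> 0" "pcompose P [:0, d:] = smult c P" "Gcd J \<noteq> 1 \<Longrightarrow> d \<noteq> 1"
  proof (cases "Gcd J = 1")
    case True
    show ?thesis by (rule that[of 1 1]) (simp_all add: True pcompose_idR)
  next
    case False
    define N where "N = Gcd J"
    \<comment> \<open>\<open>J\<close> contains n - l > 0, so its gcd is not 0 and the primitive
      N-th root of unity below makes sense.\<close>
    have N0: "N \<noteq> 0" using nJ by (auto simp: N_def Gcd_0_iff)
    define d where "d = cis (2 * pi / real N)"
    have "d ^ N = cis (real N * (2 * pi / real N))" unfolding d_def by (rule Complex.DeMoivre)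
    also have "real N * (2 * pi / real N) = 2 * pi" using N0 by simp
    finally have dN: "d ^ N = 1" by simp
    have d1: "d \<noteq> 1"
    proof
      assume "d = 1"
      hence "cos (2 * pi / real N) = 1" by (simp add: d_def complex_eq_iff)
      then obtain k :: int where k: "2 * pi / real N = of_int k * 2 * pi" by (auto simp: cos_one_2pi_int)
      hence "of_int (k * int N) = (1::real)" using N0 by (simp add: field_simps)
      hence "k * int N = 1" by (simp only: of_int_eq_1_iff)
      hence "int N dvd 1" by (metis dvd_triv_right)
      thus False using False by (simp add: N_def)
    qed
    have "d ^ i = d ^ l" if "i \<in> I" for i
    proof -
      have "N dvd i - l" using that unfolding N_def assms(7) by (intro Gcd_dvd) blast
      then obtain k where "i - l = N * k" by auto
      hence "i = l + N * k" using l(2)[OF that] by simp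
      thus ?thesis by (simp add: power_add power_mult dN)
    qed
    hence "pcompose P [:0, d:] = smult (d ^ l) P"
      by (intro poly_eqI) (auto simp: coeff_pcompose_linear assms(5))
    thus ?thesis using d1 by (intro that[of d "d ^ l"]) (auto simp: d_def)
  qed
  have rat: "strong_uniqueness_poly_rational P \<longleftrightarrow> Gcd J = 1" if "n - m \<ge> 3"
  proof
    assume sup: "strong_uniqueness_poly_rational P"
    show "Gcd J = 1"
    proof (rule ccontr)
      assume J: "Gcd J \<noteq> 1"
      define g :: "complex poly fract" where "g = to_fract [:0, 1:]"
      have mult: "rat_const d * g \<notin> range rat_const"
        using counter(1) by (auto simp: g_def rat_const_def simp flip: to_fract_mult)
      moreover have "g \<notin> range rat_const" by (auto simp: g_def rat_const_def)
      moreover have "rat_eval P (rat_const d * g) = rat_const c * rat_eval P g"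
        using arg_cong[OF counter(3), of "\<lambda>Q. rat_eval Q g"] by (simp add: mult.commute)
      ultimately have "rat_const d * g = g"
        using sup counter(2) unfolding strong_uniqueness_poly_rational_def by blast
      hence "rat_const d = 1" by (simp add: g_def)
      thus False using counter(4)[OF J] by (metis rat_const_1 rat_const_eq_iff)
    qed
  next
    assume J: "Gcd J = 1"
    show "strong_uniqueness_poly_rational P"
      unfolding strong_uniqueness_poly_rational_def
    proof (intro allI impI)
      fix f g c
      assume "f \<notin> range rat_const" and g: "g \<notin> range rat_const" and c: "c \<noteq> 0"
        and eq: "rat_eval P f = rat_const c * rat_eval P g"
      have "m + 3 \<le> degree P" using that assms(1) degP by simp
      then obtain d where d: "f = rat_const d * g" "pcompose P [:0, d:] = smult c P"
        using rational_multiple[OF gap _ c g eq] by blast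
      have "c = 1 \<and> d = 1" by (rule unique[OF J d(2) c])
      thus "c = 1 \<and> f = g" using d(1) by simp
    qed
  qed
  have mer: "strong_uniqueness_poly_meromorphic P \<longleftrightarrow> Gcd J = 1" if "n - m \<ge> 4"
  proof
    assume sup: "strong_uniqueness_poly_meromorphic P"
    show "Gcd J = 1"
    proof (rule ccontr)
      assume J: "Gcd J \<noteq> 1"
      have nonconst: "nonconst_meromorphic (\<lambda>z. b * z)" if "b \<noteq> 0" for b
      proof -
        have "\<not> (\<forall>\<^sub>\<approx>z. b * z = k)" for k
        proof
          assume "\<forall>\<^sub>\<approx>z. b * z = k"
          moreover have "\<forall>\<^sub>\<approx>z. z \<notin> {k / b}" by (rule eventually_not_in_cosparse) simp
          ultimately have "\<forall>\<^sub>\<approx>(z::complex). False" by eventually_elim (use that in \<open>auto simp: field_simps\<close>)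
          thus False by simp
        qed
        moreover have "(\<lambda>z. b * z) meromorphic_on UNIV" by (intro meromorphic_intros)
        ultimately show ?thesis by (auto simp: nonconst_meromorphic_def)
      qed
      \<comment> \<open>Writing \<open>1 * z\<close> lets \<open>nonconst\<close> cover both
        functions of the pair.\<close>
      have "poly P (d * z) = c * poly P (1 * z)" for z
        using arg_cong[OF counter(3), of "\<lambda>Q. poly Q z"] by (simp add: poly_pcompose mult.commute)
      hence "\<forall>\<^sub>\<approx>z. poly P (d * z) = c * poly P (1 * z)" by simp
      from sup[unfolded strong_uniqueness_poly_meromorphic_def, rule_format, OF nonconst[OF counter(1)] nonconst[OF one_neq_zero] counter(2) this]
      have "\<forall>\<^sub>\<approx>z. d * z = 1 * z" by (rule conjunct2)
      moreover have "\<forall>\<^sub>\<approx>z. z \<notin> {0::complex}" by (rule eventually_not_in_cosparse) simp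
      ultimately have "\<forall>\<^sub>\<approx>(z::complex). False" by eventually_elim (use counter(4)[OF J] in auto)
      thus False by simp
    qed
  next
    assume J: "Gcd J = 1"
    show "strong_uniqueness_poly_meromorphic P"
      unfolding strong_uniqueness_poly_meromorphic_def
    proof (intro allI impI)
      fix f g c
      assume f: "nonconst_meromorphic f" and g: "nonconst_meromorphic g" and c: "c \<noteq> 0"
        and eq: "\<forall>\<^sub>\<approx>z. poly P (f z) = c * poly P (g z)"
      have "m + 4 \<le> degree P" using that assms(1) degP by simp
      moreover have "f meromorphic_on UNIV" using f by (simp add: nonconst_meromorphic_def)
      ultimately obtain d where d: "\<forall>\<^sub>\<approx>z. f z = d * g z" "pcompose P [:0, d:] = smult c P"
        using meromorphic_multiple[OF gap _ c _ g eq] by blast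
      have "c = 1 \<and> d = 1" by (rule unique[OF J d(2) c])
      thus "c = 1 \<and> (\<forall>\<^sub>\<approx>z. f z = g z)" using d(1) by simp
    qed
  qed
  show ?thesis using rat mer GcdI by blast
qed

end
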